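(* Let $m,n,k$ be integers with $0\le m<n$ and $k\ge 1$, and let $z\in\mathcal Z_m\cap\mathcal Z_n$. Suppose that there are real numbers $y_-<y_+$ such that, for every real $r\in[m,n]$, the equation $\Lambda_r(y)=z$ has a solution $y=y(r,z)\in\mathcal Y_r$ with $y(r,z)\in(y_-,y_+)$, and that at each of the four points $(t,y)\in\{m,n\}\times\{y_-,y_+\}$ $$\int_S(1+|T(u)|)(1+|u|+|B(u)|)\,e^{uy-tB(u)}\,\mu(du)<\infty .$$ Then $$K_{m,k}^T(z,\cdot)\ \geq_{\mathrm{cx}}\ K_{n,k}^T(z,\cdot).$$
   Context: Exponential family. Let $\nu$ be a $\sigma$-finite measure on $\mathbb R$, $N:=\{u\in\mathbb R:\int_{\mathbb R} e^{ux}\nu(dx)<\infty\}$, with interior $N^\circ$, and $B(u):=\log\int_{\mathbb R} e^{ux}\nu(dx)$. For $u\in N$ let $P_u(dx):=e^{ux-B(u)}\nu(dx)$, a probability measure. It is assumed that $B''(u)=\mathrm{Var}_{P_u}(X)>0$ on $N^\circ$ (nondegeneracy). Let $\mu$ be a probability measure on $\mathbb R$ (the prior of a parameter $\Theta$) with support $S:=\operatorname{supp}\mu\subseteq N^\circ$. Conditionally on $\Theta=u$, the observations $X_1,X_2,\dots$ are i.i.d. with law $P_u$. Let $T:S\to\mathbb R$ be non-decreasing, $\mu$-integrable and not $\mu$-a.s. constant. Interpolated posterior. For real $t\ge 0$ let $$\mathcal Y_t:=\Big\{y\in\mathbb R:\int_S(1+|T(u)|)e^{uy-tB(u)}\mu(du)<\infty\Big\},$$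 and for $y\in\mathcal Y_t$ $$\mu_{t,y}(du):=\frac{e^{uy-tB(u)}\mu(du)}{\int_S e^{uv_y}\,}\Big|_{\text{normalized}},\quad\text{i.e. } \mu_{t,y}(du)=\frac{e^{uy-tB(u)}\mu(du)}{\int_S e^{u'y-tB(u')}\mu(du')},\qquad \Lambda_t(y):=\int_S T(u)\,\mu_{t,y}(du).$$ The set $\mathcal Y_t$ is an interval and $\Lambda_t$ is strictly increasing on it. Put $\mathcal Z_t:=\Lambda_t(\mathcal Y_t)$; for $z\in\mathcal Z_t$ let $y(t,z)\in\mathcal Y_t$ be the unique solution of $\Lambda_t(y(t,z))=z$, and $\mu_{t,z}:=\mu_{t,y(t,z)}$. Transition kernel. Fix $u_*\in N^\circ$. For an integer $k\ge1$ let $P_u^{(k)}$ be the law of $X_1+\cdots+X_k$ when $X_1,\dots,X_k$ are i.i.d. with law $P_u$, and $$\ell_k(u,x):=\frac{dP_u^{(k)}}{dP_{u_*}^{(k)}}(x)=\exp\{(u-u_* )x-k(B(u)-B(u_* ))\}.$$ For $z\in\mathcal Z_t$ set $\rho_{t,k}(z,x):=\int_S\ell_k(u,x)\mu_{t,z}(du)$, $\eta_{t,k}(z,x):=\int_S|T(u)|\ell_k(u,x)\mu_{t,z}(du)$, and $$M_{t,z}^{(k)}(x):=\frac{\int_S T(u)\ell_k(u,x)\mu_{t,z}(du)}{\rho_{t,k}(z,x)}\ \text{ if } 0<\rho_{t,k}(z,x)<\infty \text{ and } \eta_{t,k}(z,x)<\infty,\qquad M_{t,z}^{(k)}(x):=z\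 \text{ otherwise.}$$ For Borel $C\subseteq\mathbb R$, $$K_{t,k}^T(z,C):=\int_{\mathbb R}\mathbf 1_C\big(M_{t,z}^{(k)}(x)\big)\int_S P_u^{(k)}(dx)\,\mu_{t,z}(du),\qquad z\in\mathcal Z_t .$$ Convex order. For probability measures $\alpha,\beta$ on $\mathbb R$ with finite and equal means, $\beta\geq_{\mathrm{cx}}\alpha$ means $\int f\,d\beta\ge\int f\,d\alpha$ for every convex $f:\mathbb R\to\mathbb R$ for which both integrals exist; equivalently $\int(x-a)^+\alpha(dx)\le\int(x-a)^+\beta(dx)$ for every $a\in\mathbb R$. *)

theory Defs
  imports "HOL-Probability.Probability"
begin

definition msupport :: "real measure \<Rightarrow> real set" where
  "msupport M = {x. \<forall>U. open U \<and> x \<in> U \<longrightarrow> emeasure M U > 0}"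

definition natural_params :: "real measure \<Rightarrow> real set" where
  "natural_params \<nu> = {u. (\<integral>\<^sup>+x. ennreal (exp (u * x)) \<partial>\<nu>) < \<infinity>}"

text \<open>Meaningful only for parameters in \<open>natural_params \<nu>\<close>; elsewhere the Bochner integral
  is 0 by convention and the value is never used.\<close>
definition cumulant :: "real measure \<Rightarrow> real \<Rightarrow> real" where
  "cumulant \<nu> u = ln (\<integral>x. exp (u * x) \<partial>\<nu>)"

definition expfam :: "real measure \<Rightarrow> real \<Rightarrow> real measure" where
  "expfam \<nu> u = density \<nu> (\<lambda>x. ennreal (exp (u * x - cumulant \<nu> u)))"

definition expfam_sum :: "real measure \<Rightarrow> nat \<Rightarrow> real \<Rightarrow> real measure" where
  "expfam_sum \<nu> k u = distr (PiM {..<k} (\<lambda>_. expfam \<nu> u)) borel (\<lambda>\<omega>. \<Sum>i<k. \<omega> i)"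

text \<open>\<open>T\<close> is a function on the support \<open>msupport \<mu>\<close> of the prior. It is represented by a total
  function, and every integral involving it is restricted to that support.\<close>

definition tilt :: "real measure \<Rightarrow> real \<Rightarrow> real \<Rightarrow> real \<Rightarrow> real" where
  "tilt \<nu> t y u = exp (u * y - t * cumulant \<nu> u)"

definition post_dom :: "real measure \<Rightarrow> real measure \<Rightarrow> (real \<Rightarrow> real) \<Rightarrow> real \<Rightarrow> real set" where
  "post_dom \<nu> \<mu> T t =
     {y. (\<integral>\<^sup>+u\<in>msupport \<mu>. ennreal ((1 + \<bar>T u\<bar>) * tilt \<nu> t y u) \<partial>\<mu>) < \<infinity>}"

definition post :: "real measure \<Rightarrow> real measure \<Rightarrow> real \<Rightarrow> real \<Rightarrow> real measure" where
  "post \<nu> \<mu> t y = density \<mu> (\<lambda>u. ennreal (tilt \<nu> t y u / (LINT v:msupport \<mu>|\<mu>. tilt \<nu> t y v))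
                                    * indicator (msupport \<mu>) u)"

definition post_mean ::
  "real measure \<Rightarrow> real measure \<Rightarrow> (real \<Rightarrow> real) \<Rightarrow> real \<Rightarrow> real \<Rightarrow> real" where
  "post_mean \<nu> \<mu> T t y = (LINT u:msupport \<mu>|post \<nu> \<mu> t y. T u)"

definition post_range :: "real measure \<Rightarrow> real measure \<Rightarrow> (real \<Rightarrow> real) \<Rightarrow> real \<Rightarrow> real set" where
  "post_range \<nu> \<mu> T t = post_mean \<nu> \<mu> T t ` post_dom \<nu> \<mu> T t"

text \<open>Under the standing assumptions \<open>post_mean \<nu> \<mu> T t\<close> is strictly increasing on
  \<open>post_dom \<nu> \<mu> T t\<close>, so the description is proper for \<open>z \<in> post_range \<nu> \<mu> T t\<close>.\<close>
definition post_stat ::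
  "real measure \<Rightarrow> real measure \<Rightarrow> (real \<Rightarrow> real) \<Rightarrow> real \<Rightarrow> real \<Rightarrow> real" where
  "post_stat \<nu> \<mu> T t z = (THE y. y \<in> post_dom \<nu> \<mu> T t \<and> post_mean \<nu> \<mu> T t y = z)"

definition post_at ::
  "real measure \<Rightarrow> real measure \<Rightarrow> (real \<Rightarrow> real) \<Rightarrow> real \<Rightarrow> real \<Rightarrow> real measure" where
  "post_at \<nu> \<mu> T t z = post \<nu> \<mu> t (post_stat \<nu> \<mu> T t z)"

text \<open>The explicit form of the density of \<open>expfam_sum \<nu> k u\<close> with respect to
  \<open>expfam_sum \<nu> k u0\<close>.\<close>
definition lik :: "real measure \<Rightarrow> real \<Rightarrow> nat \<Rightarrow> real \<Rightarrow> real \<Rightarrow> real" where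
  "lik \<nu> u0 k u x = exp ((u - u0) * x - real k * (cumulant \<nu> u - cumulant \<nu> u0))"

definition rho :: "real measure \<Rightarrow> real measure \<Rightarrow> (real \<Rightarrow> real) \<Rightarrow> real \<Rightarrow> real \<Rightarrow> nat \<Rightarrow>
    real \<Rightarrow> real \<Rightarrow> ennreal" where
  "rho \<nu> \<mu> T u0 t k z x =
     (\<integral>\<^sup>+u\<in>msupport \<mu>. ennreal (lik \<nu> u0 k u x) \<partial>post_at \<nu> \<mu> T t z)"

definition eta :: "real measure \<Rightarrow> real measure \<Rightarrow> (real \<Rightarrow> real) \<Rightarrow> real \<Rightarrow> real \<Rightarrow> nat \<Rightarrow>
    real \<Rightarrow> real \<Rightarrow> ennreal" where
  "eta \<nu> \<mu> T u0 t k z x =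
     (\<integral>\<^sup>+u\<in>msupport \<mu>. ennreal (\<bar>T u\<bar> * lik \<nu> u0 k u x) \<partial>post_at \<nu> \<mu> T t z)"

definition upd_mean :: "real measure \<Rightarrow> real measure \<Rightarrow> (real \<Rightarrow> real) \<Rightarrow> real \<Rightarrow> real \<Rightarrow> nat \<Rightarrow>
    real \<Rightarrow> real \<Rightarrow> real" where
  "upd_mean \<nu> \<mu> T u0 t k z x =
     (if 0 < rho \<nu> \<mu> T u0 t k z x \<and> rho \<nu> \<mu> T u0 t k z x < \<infinity> \<and> eta \<nu> \<mu> T u0 t k z x < \<infinity>
      then (LINT u:msupport \<mu>|post_at \<nu> \<mu> T t z. T u * lik \<nu> u0 k u x)
             / enn2real (rho \<nu> \<mu> T u0 t k z x)
      else z)"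

text \<open>The mixture of the laws \<open>expfam_sum \<nu> k u\<close>, where \<open>u\<close> has law \<open>post_at \<nu> \<mu> T t z\<close>. The
  mixing measure is restricted to the support of \<open>\<mu>\<close>, which carries all of its mass, because
  \<open>expfam \<nu> u\<close> need not be a probability measure for other \<open>u\<close>.\<close>
definition predictive :: "real measure \<Rightarrow> real measure \<Rightarrow> (real \<Rightarrow> real) \<Rightarrow> real \<Rightarrow> nat \<Rightarrow>
    real \<Rightarrow> real measure" where
  "predictive \<nu> \<mu> T t k z =
     restrict_space (post_at \<nu> \<mu> T t z) (msupport \<mu>) \<bind> expfam_sum \<nu> k"

text \<open>The measure \<open>trans_kernel \<nu> \<mu> T u0 t k z\<close> gives a Borel set \<open>C\<close> the integral of
  \<open>indicator C (upd_mean \<nu> \<mu> T u0 t k z x)\<close> over \<open>x\<close> with law \<open>predictive \<nu> \<mu> T t k z\<close>.\<close>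
definition trans_kernel :: "real measure \<Rightarrow> real measure \<Rightarrow> (real \<Rightarrow> real) \<Rightarrow> real \<Rightarrow> real \<Rightarrow>
    nat \<Rightarrow> real \<Rightarrow> real measure" where
  "trans_kernel \<nu> \<mu> T u0 t k z =
     distr (predictive \<nu> \<mu> T t k z) borel (upd_mean \<nu> \<mu> T u0 t k z)"

text \<open>The order is defined between Borel probability measures with finite and equal means; these
  requirements are part of the predicate. For such measures a convex function has an integrable
  negative part, and restricting to convex functions with finite integrals does not change the
  relation, since the functions \<open>\<lambda>x. max (x - a) 0\<close> are among them.\<close>
definition cx_ge :: "real measure \<Rightarrow> real measure \<Rightarrow> bool" (infix "\<ge>\<^sub>c\<^sub>x" 50) where
  "\<beta> \<ge>\<^sub>c\<^sub>x \<alpha> \<longleftrightarrow>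
     prob_space \<alpha> \<and> prob_space \<beta> \<and> sets \<alpha> = sets borel \<and> sets \<beta> = sets borel \<and>
     integrable \<alpha> (\<lambda>x. x) \<and> integrable \<beta> (\<lambda>x. x) \<and> (\<integral>x. x \<partial>\<alpha>) = (\<integral>x. x \<partial>\<beta>) \<and>
     (\<forall>f. convex_on UNIV f \<and> integrable \<alpha> f \<and> integrable \<beta> f \<longrightarrow>
        (\<integral>x. f x \<partial>\<beta>) \<ge> (\<integral>x. f x \<partial>\<alpha>))"

end

theory Submission
  imports Defs
begin

text \<open>
Why the kernel at the earlier time dominates. Fix \<open>z\<close>, write \<open>P\<^sub>t\<close> for the posterior at time \<open>t\<close> whose
\<open>T\<close>-mean is \<open>z\<close>, and write \<open>h(u)\<close> for the probability under \<open>u\<close> that the sum of the next \<open>k\<close>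
observations lies in a Borel set \<open>A\<close>.

Two laws with the same mean are compared in convex order as soon as they are compared on the hinge
functions \<open>(x - a)\<^sup>+\<close> (\<open>convex_order_if_hinges\<close>). The updated mean is a ratio \<open>\<tau>/r\<close> in which \<open>r\<close> is the
density of the predictive law with respect to a fixed reference law. Therefore the hinge integral of
the kernel is the integral of \<open>(\<tau> - a r)\<^sup>+\<close> under the reference law, which is the largest value of
\<open>E\<^sub>t[(T - a) h]\<close> as \<open>A\<close> ranges over all Borel sets. Since the updated mean is non-decreasing in the
observed sum, the maximum is attained at a half-line (\<open>K_hinge_ge\<close>, \<open>K_hinge_attained\<close>), and for a
half-line \<open>h\<close> is non-decreasing. So it is enough to show \<open>E\<^sub>n[(T - a) h] \<le> E\<^sub>m[(T - a) h]\<close> for the one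
half-line that is optimal at the later time \<open>n\<close>.

The density of \<open>P\<^sub>m\<close> with respect to \<open>P\<^sub>n\<close> is a constant times \<open>exp (u d + (n - m) B(u))\<close>. It is log-convex,
because the cumulant function \<open>B\<close> is convex. Hence \<open>Q = 1 - dP\<^sub>m/dP\<^sub>n\<close> is quasi-concave in \<open>u\<close>, and since
\<open>P\<^sub>m\<close> and \<open>P\<^sub>n\<close> have the same mass and the same \<open>T\<close>-mean, \<open>Q\<close> is orthogonal to \<open>1\<close> and to \<open>T\<close> under
\<open>P\<^sub>n\<close>. The inequality to prove reads \<open>E\<^sub>n[(T - a) h Q] \<le> 0\<close> (\<open>weighted_integral_nonpos\<close>), and by
orthogonality \<open>h\<close> may be replaced in it by \<open>h - \<alpha>\<close> for any constant \<open>\<alpha>\<close>. The set \<open>{Q > 0}\<close> is an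
interval. If \<open>a\<close> lies strictly between values of \<open>T\<close> on this interval, a suitable \<open>\<alpha>\<close> makes
\<open>(T - a) (h - \<alpha>)\<close> smaller inside the interval than outside, and the claim follows from \<open>E\<^sub>n Q = 0\<close>.
If \<open>a\<close> lies on one side of all these values, monotonicity of \<open>T\<close> and \<open>h\<close> alone does not suffice;
there the optimality of the half-line enters through \<open>E\<^sub>n[(T - a) h] \<ge> 0\<close> and
\<open>E\<^sub>n[(T - a) (1 - h)] \<le> 0\<close>, which say that \<open>A\<close> does at least as well as the empty set and as the whole line.
\<close>

section \<open>Correlation of similarly ordered functions\<close>

text \<open>Chebyshev's association inequality. Integrating \<open>(f u - f v) (g u - g v) \<ge> 0\<close> first over \<open>v\<close> and then
over \<open>u\<close> gives twice the covariance. In the case of equality almost every inner integral vanishes,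
so one can pick a single \<open>u\<close> for which the product is zero for almost all \<open>v\<close>.\<close>

lemma (in prob_space) similarly_ordered_expectation:
  fixes f g :: "'a \<Rightarrow> real"
  assumes S: "AE u in M. u \<in> S"
    and f: "integrable M f" and g: "integrable M g" and fg: "integrable M (\<lambda>u. f u * g u)"
    and similar: "\<And>u v. u \<in> S \<Longrightarrow> v \<in> S \<Longrightarrow> 0 \<le> (f u - f v) * (g u - g v)"
  shows similarly_ordered_expectation_mult_le:
      "expectation f * expectation g \<le> expectation (\<lambda>u. f u * g u)"
    and similarly_ordered_expectation_mult_eq:
      "expectation f * expectation g = expectation (\<lambda>u. f u * g u) \<Longrightarrow>
        \<exists>u\<in>S. AE v in M. (f u - f v) * (g u - g v) = 0"
proof -
  define d where "d u = (\<integral>v. (f u - f v) * (g u - g v) \<partial>M)" for u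
  have split: "(f u - f v) * (g u - g v) = f u * g u - f u * g v - g u * f v + f v * g v" for u v
    by (simp add: algebra_simps)
  have int: "integrable M (\<lambda>v. (f u - f v) * (g u - g v))" for u
    unfolding split using f g fg by auto
  have d_eq: "d u = f u * g u - expectation g * f u - expectation f * g u
      + expectation (\<lambda>v. f v * g v)" for u
    unfolding d_def split using f g fg by (simp add: prob_space mult.commute)
  have d_int: "integrable M d"
    unfolding d_eq using f g fg by auto
  have d_integral: "expectation d
      = 2 * (expectation (\<lambda>u. f u * g u) - expectation f * expectation g)"
    unfolding d_eq using f g fg by (simp add: prob_space mult.commute)
  have nonneg: "AE v in M. 0 \<le> (f u - f v) * (g u - g v)" if "u \<in> S" for u
    using S by eventually_elim (rule similar[OF that])
  have d_nonneg: "AE u in M. 0 \<le> d u"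
    using S by eventually_elim (auto simp: d_def intro!: integral_nonneg_AE nonneg)
  then have "0 \<le> expectation d"
    by (rule integral_nonneg_AE)
  then show "expectation f * expectation g \<le> expectation (\<lambda>u. f u * g u)"
    unfolding d_integral by simp
  assume "expectation f * expectation g = expectation (\<lambda>u. f u * g u)"
  then have "AE u in M. d u = 0"
    using integral_nonneg_eq_0_iff_AE[OF d_int d_nonneg] d_integral by simp
  with S have AE: "AE u in M. u \<in> S \<and> d u = 0"
    by eventually_elim simp
  have "\<exists>u. u \<in> S \<and> d u = 0"
  proof (rule ccontr)
    assume "\<not> ?thesis"
    then have "\<And>u. (u \<in> S \<and> d u = 0) \<longleftrightarrow> False" by auto
    with AE have "AE u in M. False" by simp
    then show False by simp
  qed
  then obtain u where u: "u \<in> S" "d u = 0" by blast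
  have "AE v in M. (f u - f v) * (g u - g v) = 0"
    using integral_nonneg_eq_0_iff_AE[OF int nonneg[OF u(1)]] u(2) by (simp add: d_def)
  with u show "\<exists>u\<in>S. AE v in M. (f u - f v) * (g u - g v) = 0" by blast
qed

section \<open>Reweighting by a quasi-concave function\<close>

text \<open>The function \<open>p\<close> carries the order of the points. Because the order enters only through \<open>p\<close>, the
left-right mirror image of the situation is again an instance (lemma \<open>reflection\<close> below), and each
one-sided case has to be treated only once. The function \<open>Q\<close> is the difference of two densities that
give \<open>1\<close> and \<open>T\<close> the same integrals; quasi-concavity makes its sign pattern \<open>-, +, -\<close>.\<close>

locale unimodal_weight = finite_measure M for M :: "'a measure" +
  fixes S :: "'a set" and p T h Q :: "'a \<Rightarrow> real"
  assumes AE_S: "AE u in M. u \<in> S"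
    and T_mono: "\<And>u v. u \<in> S \<Longrightarrow> v \<in> S \<Longrightarrow> p u \<le> p v \<Longrightarrow> T u \<le> T v"
    and h_mono: "\<And>u v. u \<in> S \<Longrightarrow> v \<in> S \<Longrightarrow> p u \<le> p v \<Longrightarrow> h u \<le> h v"
    and h_nonneg: "\<And>u. u \<in> S \<Longrightarrow> 0 \<le> h u"
    and h_le_1: "\<And>u. u \<in> S \<Longrightarrow> h u \<le> 1"
    and Q_quasiconcave: "\<And>u v w. u \<in> S \<Longrightarrow> v \<in> S \<Longrightarrow> w \<in> S \<Longrightarrow> p u \<le> p v \<Longrightarrow> p v \<le> p w \<Longrightarrow>
          min (Q u) (Q w) \<le> Q v"
    and h_measurable [measurable]: "h \<in> borel_measurable M"
    and T_integrable [simp]: "integrable M T"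
    and Q_integrable [simp]: "integrable M Q"
    and TQ_integrable [simp]: "integrable M (\<lambda>u. T u * Q u)"
    and Q_mean: "(\<integral>u. Q u \<partial>M) = 0"
    and TQ_mean: "(\<integral>u. T u * Q u \<partial>M) = 0"
begin

lemma integrable_mult_h: "integrable M (\<lambda>u. f u * h u)" if "integrable M f" for f :: "'a \<Rightarrow> real"
proof (rule Bochner_Integration.integrable_bound[OF that])
  show "(\<lambda>u. f u * h u) \<in> borel_measurable M" using that by measurable
  show "AE u in M. norm (f u * h u) \<le> norm (f u)"
    using AE_S by eventually_elim
      (use h_nonneg h_le_1 in \<open>auto simp: abs_mult intro!: mult_left_le\<close>)
qed

lemma integrable_products [simp]:
  "integrable M h" "integrable M (\<lambda>u. T u * h u)"
  "integrable M (\<lambda>u. h u * Q u)" "integrable M (\<lambda>u. T u * h u * Q u)"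
  using integrable_mult_h[of "\<lambda>_. 1"] integrable_mult_h[OF T_integrable]
    integrable_mult_h[OF Q_integrable] integrable_mult_h[OF TQ_integrable]
  by (simp_all add: mult_ac)

text \<open>Orthogonality of \<open>Q\<close> to \<open>1\<close> and \<open>T\<close> makes the choice of \<open>\<alpha>\<close> free.\<close>

lemma shift_integral:
  "(\<integral>u. (T u - a) * (h u - \<alpha>) * Q u \<partial>M) = (\<integral>u. (T u - a) * h u * Q u \<partial>M)"
  "integrable M (\<lambda>u. (T u - a) * (h u - \<alpha>) * Q u)"
  "integrable M (\<lambda>u. (T u - a) * h u)"
proof -
  have eq: "(T u - a) * (h u - \<alpha>) * Q u = T u * h u * Q u - a * (h u * Q u)
      - \<alpha> * (T u * Q u) + \<alpha> * a * Q u" for u \<alpha>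
    by (simp add: algebra_simps)
  show "integrable M (\<lambda>u. (T u - a) * (h u - \<alpha>) * Q u)"
    unfolding eq by simp
  show "(\<integral>u. (T u - a) * (h u - \<alpha>) * Q u \<partial>M) = (\<integral>u. (T u - a) * h u * Q u \<partial>M)"
    using eq[of _ 0] by (simp add: eq Q_mean TQ_mean)
  show "integrable M (\<lambda>u. (T u - a) * h u)"
    by (simp add: left_diff_distrib)
qed

lemma integral_nonpos_of_bound:
  assumes "\<And>u. u \<in> S \<Longrightarrow> (T u - a) * (h u - \<alpha>) * Q u \<le> b * Q u"
  shows "(\<integral>u. (T u - a) * h u * Q u \<partial>M) \<le> 0"
proof -
  have "(\<integral>u. (T u - a) * (h u - \<alpha>) * Q u \<partial>M) \<le> (\<integral>u. b * Q u \<partial>M)"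
    using AE_S by (intro integral_mono_AE shift_integral) (auto elim!: eventually_mono assms)
  then show ?thesis by (simp add: shift_integral Q_mean)
qed

lemma Q_zero_trivial:
  assumes "\<And>u. u \<in> S \<Longrightarrow> s * Q u \<ge> 0" and "s \<noteq> 0"
  shows "(\<integral>u. (T u - a) * h u * Q u \<partial>M) = 0"
proof -
  have "AE u in M. 0 \<le> s * Q u" using AE_S by (auto elim!: eventually_mono intro: assms(1))
  then have "AE u in M. s * Q u = 0"
    by (subst integral_nonneg_eq_0_iff_AE[symmetric]) (auto simp: Q_mean)
  then have "AE u in M. (T u - a) * h u * Q u = 0"
    using assms(2) by (auto elim!: eventually_mono)
  then show ?thesis by (rule integral_eq_zero_AE)
qed

text \<open>A point between two points of \<open>{Q > 0}\<close> belongs to this set, so every other point lies to the left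
of the whole set or to the right of the whole set.\<close>

lemma nonpos_outside:
  assumes "u \<in> S" "Q u \<le> 0"
  shows "(\<forall>j\<in>S. 0 < Q j \<longrightarrow> p u < p j) \<or> (\<forall>j\<in>S. 0 < Q j \<longrightarrow> p j < p u)"
proof (rule ccontr)
  assume "\<not> ?thesis"
  then obtain i j where "i \<in> S" "0 < Q i" "p i \<le> p u" "j \<in> S" "0 < Q j" "p u \<le> p j"
    by (auto simp: not_less)
  then show False using Q_quasiconcave[of i u j] assms by auto
qed

text \<open>The case in which \<open>T\<close> reaches \<open>a\<close> only to the right of \<open>{Q > 0}\<close>. Let \<open>\<alpha>\<close> be the infimum of \<open>h\<close> on
\<open>{Q > 0}\<close>. Up to the right end of \<open>{Q > 0}\<close> the product \<open>(T - a) (h - \<alpha>) Q\<close> has the desired sign. To the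
right of it, \<open>(h - \<alpha>) (- Q)\<close> is \<open>h\<close> times the factor \<open>\<phi> = (1 - \<alpha>/h) (- Q)\<close>, which is non-negative and
non-decreasing. Replacing \<open>\<phi>\<close> by its value \<open>c\<close> at the place where \<open>T\<close> crosses \<open>a\<close> only increases
\<open>- (T - a) h \<phi>\<close>, so the whole integrand is at most \<open>- c (T - a) h\<close>, whose integral is \<open>\<le> 0\<close>.\<close>

lemma weighted_integral_nonpos_above:
  assumes above: "\<And>u. u \<in> S \<Longrightarrow> 0 < Q u \<Longrightarrow> T u \<le> a"
    and gain: "0 \<le> (\<integral>u. (T u - a) * h u \<partial>M)"
  shows "(\<integral>u. (T u - a) * h u * Q u \<partial>M) \<le> 0"
proof -
  consider "\<forall>u\<in>S. Q u \<le> 0" | "\<forall>u\<in>S. T u \<le> a"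
    | j w where "j \<in> S" "0 < Q j" "w \<in> S" "a < T w"
    by (force simp: not_le)
  then show ?thesis
  proof cases
    case 1
    then show ?thesis using Q_zero_trivial[of "-1" a] by simp
  next
    case 2
    have "AE u in M. 0 \<le> (a - T u) * h u"
      using AE_S by eventually_elim (use 2 h_nonneg in auto)
    moreover have int: "integrable M (\<lambda>u. (a - T u) * h u)"
      by (simp add: left_diff_distrib)
    moreover have "(\<integral>u. (a - T u) * h u \<partial>M) = - (\<integral>u. (T u - a) * h u \<partial>M)"
      by (simp add: integral_minus[symmetric] algebra_simps del: integral_minus)
    moreover have "0 \<le> (\<integral>u. (a - T u) * h u \<partial>M)"
      using calculation(1) by (rule integral_nonneg_AE)
    ultimately have "(\<integral>u. (a - T u) * h u \<partial>M) = 0"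
      using gain by linarith
    then have "AE u in M. (a - T u) * h u = 0"
      using integral_nonneg_eq_0_iff_AE[OF int] \<open>AE u in M. 0 \<le> (a - T u) * h u\<close> by simp
    then have "AE u in M. (T u - a) * h u * Q u = 0"
      by eventually_elim auto
    then show ?thesis by (simp add: integral_eq_zero_AE)
  next
    case 3
    define J where "J = {u\<in>S. 0 < Q u}"
    define \<alpha> where "\<alpha> = Inf (h ` J)"
    \<comment> \<open>\<open>W\<close> lies to the right of \<open>J\<close>; the infimum \<open>c\<close> plays the role of the value of \<open>\<phi>\<close> at the
      crossing point, which need not itself belong to \<open>S\<close>.\<close>
    define W where "W = {u\<in>S. a < T u}"
    define \<phi> where "\<phi> u = (1 - \<alpha> / h u) * (- Q u)" for u
    define c where "c = Inf (\<phi> ` W)"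
    have jJ: "j \<in> J" and wW: "w \<in> W" using 3 by (auto simp: J_def W_def)
    have bdd: "bdd_below (h ` J)"
      by (rule bdd_belowI[of _ 0]) (auto simp: J_def h_nonneg)
    have \<alpha>_le: "\<alpha> \<le> h u" if "u \<in> J" for u
      unfolding \<alpha>_def using bdd that by (auto intro: cInf_lower)
    have \<alpha>_ge: "x \<le> \<alpha>" if "\<And>u. u \<in> J \<Longrightarrow> x \<le> h u" for x
      unfolding \<alpha>_def using jJ that by (auto intro!: cInf_greatest)
    have \<alpha>0: "0 \<le> \<alpha>" by (rule \<alpha>_ge) (auto simp: J_def h_nonneg)
    define U where "U = {u\<in>S. Q u \<le> 0 \<and> (\<forall>i\<in>J. p i < p u)}"
    have U_\<alpha>: "\<alpha> \<le> h u" if "u \<in> U" for u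
      using \<alpha>_le[OF jJ] h_mono[of j u] that jJ by (fastforce simp: U_def J_def)
    have WU: "W \<subseteq> U"
    proof
      fix u assume "u \<in> W"
      then have u: "u \<in> S" "a < T u" by (auto simp: W_def)
      moreover have "p i < p u" if "i \<in> J" for i
      proof (rule ccontr)
        assume "\<not> p i < p u"
        with that u T_mono[of u i] above[of i] show False by (auto simp: J_def)
      qed
      ultimately show "u \<in> U" using above[of u] by (force simp: U_def)
    qed
    \<comment> \<open>If \<open>h u = 0\<close> then \<open>\<alpha> = 0\<close>, and the convention \<open>\<alpha> / 0 = 0\<close> gives the right value.\<close>
    have factor: "0 \<le> 1 - \<alpha> / h u" "h u - \<alpha> = (1 - \<alpha> / h u) * h u" if "u \<in> S" "\<alpha> \<le> h u" for u
      using that \<alpha>0 h_nonneg[of u] by (auto simp: field_simps divide_le_eq_1)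
    have \<phi>_mono: "\<phi> u \<le> \<phi> v" if "u \<in> U" "v \<in> U" "p u \<le> p v" for u v
    proof -
      have uv: "u \<in> S" "v \<in> S" "Q u \<le> 0" "Q v \<le> 0" "p j \<le> p u"
        using that jJ by (auto simp: U_def intro: less_imp_le)
      have "Q v \<le> Q u"
        using Q_quasiconcave[of j u v] uv that 3 by (auto simp: min_def split: if_splits)
      moreover have "1 - \<alpha> / h u \<le> 1 - \<alpha> / h v"
        using h_mono[of u v] uv that \<alpha>0 U_\<alpha>[of u] h_nonneg[of u]
        by (cases "h u = 0") (auto simp: intro!: divide_left_mono mult_pos_pos)
      ultimately show ?thesis
        unfolding \<phi>_def using factor(1)[of v] U_\<alpha> that uv by (intro mult_mono) auto
    qed
    have \<phi>_nonneg: "0 \<le> \<phi> u" if "u \<in> U" for u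
      unfolding \<phi>_def using factor(1)[of u] U_\<alpha>[OF that] that by (auto simp: U_def intro!: mult_nonneg_nonpos)
    have c_le: "c \<le> \<phi> u" if "u \<in> W" for u
      unfolding c_def using that WU \<phi>_nonneg
      by (intro cInf_lower bdd_belowI[of _ 0]) auto
    have c_ge: "x \<le> c" if "\<And>u. u \<in> W \<Longrightarrow> x \<le> \<phi> u" for x
      unfolding c_def using wW that by (auto intro!: cInf_greatest)
    have c0: "0 \<le> c" using WU \<phi>_nonneg by (intro c_ge) auto
    have bound: "(T u - a) * (h u - \<alpha>) * Q u \<le> - c * ((T u - a) * h u)" if u: "u \<in> S" for u
    proof -
      have U_eq: "(T u - a) * (h u - \<alpha>) * Q u + c * ((T u - a) * h u)
          = ((T u - a) * (c - \<phi> u)) * h u" if "u \<in> U"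
        unfolding factor(2)[OF u U_\<alpha>[OF that]] \<phi>_def by algebra
      have neg: "0 \<le> - c * ((T u - a) * h u)" if "T u \<le> a"
        using that c0 h_nonneg[OF u] by (simp add: mult_nonneg_nonpos mult_nonpos_nonneg)
      consider "u \<in> W" | "T u \<le> a" "u \<in> U" | "T u \<le> a" "0 < Q u"
        | "T u \<le> a" "Q u \<le> 0" "\<forall>i\<in>J. p u < p i"
        using nonpos_outside[of u] u by (force simp: W_def U_def J_def)
      then show ?thesis
      proof cases
        case 1
        then have "((T u - a) * (c - \<phi> u)) * h u \<le> 0"
          using c_le[of u] h_nonneg[OF u]
          by (intro mult_nonpos_nonneg mult_nonneg_nonpos) (auto simp: W_def)
        then show ?thesis using U_eq 1 WU by auto
      next
        case 2
        have "\<phi> u \<le> c"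
        proof (rule c_ge)
          fix v assume "v \<in> W"
          then show "\<phi> u \<le> \<phi> v"
            using 2 WU T_mono[of v u] u by (intro \<phi>_mono) (auto simp: W_def intro: leI)
        qed
        then have "((T u - a) * (c - \<phi> u)) * h u \<le> 0"
          using 2 h_nonneg[OF u] by (intro mult_nonpos_nonneg) auto
        then show ?thesis using U_eq 2 by auto
      next
        case 3
        then have "(T u - a) * (h u - \<alpha>) * Q u \<le> 0"
          using \<alpha>_le[of u] u by (intro mult_nonpos_nonneg) (auto simp: J_def)
        with neg[OF 3(1)] show ?thesis by linarith
      next
        case 4
        then have "h u \<le> \<alpha>" using u by (intro \<alpha>_ge h_mono) (auto simp: J_def intro: less_imp_le)
        then have "(T u - a) * (h u - \<alpha>) * Q u \<le> 0"
          using 4 by (intro mult_nonneg_nonpos mult_nonpos_nonpos) auto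
        with neg[OF 4(1)] show ?thesis by linarith
      qed
    qed
    have "(\<integral>u. (T u - a) * h u * Q u \<partial>M) = (\<integral>u. (T u - a) * (h u - \<alpha>) * Q u \<partial>M)"
      by (simp add: shift_integral)
    also have "\<dots> \<le> (\<integral>u. - c * ((T u - a) * h u) \<partial>M)"
      using AE_S
      by (intro integral_mono_AE integrable_mult_right shift_integral)
        (auto elim!: eventually_mono dest: bound)
    also have "\<dots> \<le> 0" using c0 gain by simp
    finally show ?thesis .
  qed
qed

text \<open>Here nothing lies to the right of \<open>{Q > 0}\<close>. With \<open>\<alpha> = 1\<close> the product \<open>(T - a) (h - 1)\<close> is non-positive
where \<open>T \<ge> a\<close>. Where \<open>T \<le> a\<close> it equals \<open>(a - T) (1 - h)\<close>, which decreases from left to right and so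
is separated by a constant between the left part and \<open>{Q > 0}\<close>.\<close>

lemma weighted_integral_nonpos_no_upper:
  assumes upper: "\<And>u. u \<in> S \<Longrightarrow> Q u \<le> 0 \<Longrightarrow> \<exists>j\<in>S. 0 < Q j \<and> p u \<le> p j"
    and below: "j \<in> S" "0 < Q j" "T j \<le> a"
  shows "(\<integral>u. (T u - a) * h u * Q u \<partial>M) \<le> 0"
proof -
  consider "\<forall>u\<in>S. 0 \<le> Q u" | l where "l \<in> S" "Q l \<le> 0"
    by (force simp: not_le)
  then show ?thesis
  proof cases
    case 1
    then show ?thesis using Q_zero_trivial[of 1 a] by simp
  next
    case 2
    define J where "J = {u\<in>S. 0 < Q u}"
    have jJ: "j \<in> J" using below by (auto simp: J_def)
    have left: "p u \<le> p i" if "u \<in> S" "Q u \<le> 0" "i \<in> J" for u i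
      using nonpos_outside[OF that(1,2)] upper[OF that(1,2)] that(3)
      by (force simp: J_def intro: less_imp_le)
    define \<tau> \<eta> where "\<tau> = Inf (T ` J)" and "\<eta> = Inf (h ` J)"
    have bddT: "bdd_below (T ` J)" using left 2 T_mono[of l]
      by (intro bdd_belowI[of _ "T l"]) (auto simp: J_def)
    have bddh: "bdd_below (h ` J)" using left 2 h_mono[of l]
      by (intro bdd_belowI[of _ "h l"]) (auto simp: J_def)
    have J_ge: "\<tau> \<le> T u" "\<eta> \<le> h u" if "u \<in> J" for u
      unfolding \<tau>_def \<eta>_def using bddT bddh that by (auto intro: cInf_lower)
    have L_le: "T u \<le> \<tau>" "h u \<le> \<eta>" if "u \<in> S" "Q u \<le> 0" for u
      unfolding \<tau>_def \<eta>_def using jJ left[OF that] T_mono[of u] h_mono[of u] that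
      by (auto intro!: cInf_greatest simp: J_def)
    have "\<tau> \<le> a" "\<eta> \<le> 1" using J_ge[OF jJ] below h_le_1[of j] by auto
    show ?thesis
    proof (rule integral_nonpos_of_bound[where \<alpha>=1 and b="(a - \<tau>) * (1 - \<eta>)"])
      fix u assume u: "u \<in> S"
      show "(T u - a) * (h u - 1) * Q u \<le> (a - \<tau>) * (1 - \<eta>) * Q u"
      proof (cases "0 < Q u")
        case True
        then have uJ: "u \<in> J" using u by (auto simp: J_def)
        have "(a - T u) * (1 - h u) \<le> (a - \<tau>) * (1 - \<eta>)"
        proof (cases "T u \<le> a")
          case True
          then show ?thesis
            using J_ge[OF uJ] h_le_1[OF u] by (intro mult_mono) auto
        next
          case False
          then have "(a - T u) * (1 - h u) \<le> 0" using h_le_1[OF u] by (intro mult_nonpos_nonneg) auto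
          also have "0 \<le> (a - \<tau>) * (1 - \<eta>)" using \<open>\<tau> \<le> a\<close> \<open>\<eta> \<le> 1\<close> by auto
          finally show ?thesis .
        qed
        with True have "(a - T u) * (1 - h u) * Q u \<le> (a - \<tau>) * (1 - \<eta>) * Q u"
          by (intro mult_right_mono) auto
        then show ?thesis by (simp add: algebra_simps)
      next
        case False
        then have "(a - \<tau>) * (1 - \<eta>) \<le> (a - T u) * (1 - h u)"
          using L_le[OF u] \<open>\<tau> \<le> a\<close> \<open>\<eta> \<le> 1\<close> by (intro mult_mono) auto
        with False have "(a - T u) * (1 - h u) * Q u \<le> (a - \<tau>) * (1 - \<eta>) * Q u"
          by (intro mult_right_mono_neg) auto
        then show ?thesis by (simp add: algebra_simps)
      qed
    qed
  qed
qed

text \<open>Here \<open>a\<close> is crossed inside \<open>{Q > 0}\<close>, which has points of \<open>S\<close> on both sides. In the plane of the values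
\<open>(T, h)\<close> the monotone curve \<open>u \<mapsto> (T u, h u)\<close> passes the corners \<open>(\<tau>1, \<eta>1)\<close> and \<open>(\<tau>2, \<eta>2)\<close> at the two
ends of \<open>{Q > 0}\<close>. The constant \<open>\<alpha>\<close> is chosen so that both corners lie on the same hyperbola
\<open>(T - a) (h - \<alpha>) = b\<close> with \<open>b \<ge> 0\<close>, one on each branch. A non-decreasing curve crosses each branch of
this decreasing hyperbola only once, so \<open>(T - a) (h - \<alpha>) - b\<close> has the sign opposite to that of \<open>Q\<close>.\<close>

lemma weighted_integral_nonpos_inside:
  assumes l: "l \<in> S" "Q l \<le> 0" "\<And>j. j \<in> S \<Longrightarrow> 0 < Q j \<Longrightarrow> p l \<le> p j"
    and r: "r \<in> S" "Q r \<le> 0" "\<And>j. j \<in> S \<Longrightarrow> 0 < Q j \<Longrightarrow> p j \<le> p r"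
    and i: "i \<in> S" "0 < Q i" "T i < a" and j: "j \<in> S" "0 < Q j" "a < T j"
  shows "(\<integral>u. (T u - a) * h u * Q u \<partial>M) \<le> 0"
proof -
  define J where "J = {u\<in>S. 0 < Q u}"
  have ijJ: "i \<in> J" "j \<in> J" using i j by (auto simp: J_def)
  define \<tau>1 \<eta>1 \<tau>2 \<eta>2 where "\<tau>1 = Inf (T ` J)" and "\<eta>1 = Inf (h ` J)"
    and "\<tau>2 = Sup (T ` J)" and "\<eta>2 = Sup (h ` J)"
  have bdd: "bdd_below (T ` J)" "bdd_above (T ` J)"
    using T_mono[of l] T_mono[of _ r] l r
    by (auto intro!: bdd_belowI[of _ "T l"] bdd_aboveI[of _ "T r"] simp: J_def)
  have bdd_h: "bdd_below (h ` J)" "bdd_above (h ` J)"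
    using h_nonneg h_le_1 by (auto intro!: bdd_belowI[of _ 0] bdd_aboveI[of _ 1] simp: J_def)
  have J: "\<tau>1 \<le> T u" "\<eta>1 \<le> h u" "T u \<le> \<tau>2" "h u \<le> \<eta>2" if "u \<in> J" for u
    unfolding \<tau>1_def \<eta>1_def \<tau>2_def \<eta>2_def using bdd bdd_h that by (auto intro: cInf_lower cSup_upper)
  have L: "T u \<le> \<tau>1 \<and> h u \<le> \<eta>1" if "u \<in> S" "\<forall>i\<in>J. p u < p i" for u
    unfolding \<tau>1_def \<eta>1_def using ijJ T_mono[of u] h_mono[of u] that
    by (auto intro!: cInf_greatest simp: J_def intro: less_imp_le)
  have U: "\<tau>2 \<le> T u \<and> \<eta>2 \<le> h u" if "u \<in> S" "\<forall>i\<in>J. p i < p u" for u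
    unfolding \<tau>2_def \<eta>2_def using ijJ T_mono[of _ u] h_mono[of _ u] that
    by (auto intro!: cSup_least simp: J_def intro: less_imp_le)
  have \<tau>: "\<tau>1 < a" "a < \<tau>2" "\<eta>1 \<le> \<eta>2" using J[OF ijJ(1)] J[OF ijJ(2)] i j by auto
  define s where "s = (\<tau>2 - a) / (\<tau>2 - \<tau>1)"
  define \<alpha> where "\<alpha> = \<eta>1 + s * (\<eta>2 - \<eta>1)"
  define b where "b = (\<tau>2 - a) * (\<eta>2 - \<alpha>)"
  have s: "0 \<le> s" "s \<le> 1" "1 - s = (a - \<tau>1) / (\<tau>2 - \<tau>1)" using \<tau> by (auto simp: s_def field_simps)
  have \<alpha>: "\<eta>1 \<le> \<alpha>" "\<alpha> \<le> \<eta>2"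
    using s(1,2) \<tau>(3) mult_right_mono[of s 1 "\<eta>2 - \<eta>1"] by (auto simp: \<alpha>_def)
  \<comment> \<open>Both corners lie on the same hyperbola.\<close>
  have b2: "b = (a - \<tau>1) * (\<alpha> - \<eta>1)"
  proof -
    have "\<eta>2 - \<alpha> = (1 - s) * (\<eta>2 - \<eta>1)" "\<alpha> - \<eta>1 = s * (\<eta>2 - \<eta>1)"
      by (auto simp: \<alpha>_def algebra_simps)
    then show ?thesis by (simp add: b_def s(3)) (simp add: s_def)
  qed
  have b0: "0 \<le> b" using \<tau> \<alpha> by (simp add: b_def)
  show ?thesis
  proof (rule integral_nonpos_of_bound[where \<alpha>=\<alpha> and b=b])
    fix u assume u: "u \<in> S"
    show "(T u - a) * (h u - \<alpha>) * Q u \<le> b * Q u"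
    proof (cases "0 < Q u")
      case True
      then have uJ: "u \<in> J" using u by (auto simp: J_def)
      have "(T u - a) * (h u - \<alpha>) \<le> b"
      proof (cases "(T u - a) * (h u - \<alpha>) \<le> 0")
        case False
        then consider "a \<le> T u" "\<alpha> \<le> h u" | "T u \<le> a" "h u \<le> \<alpha>"
          by (auto simp: not_le zero_less_mult_iff)
        then show ?thesis
        proof cases
          case 1
          then show ?thesis unfolding b_def using J[OF uJ] by (intro mult_mono) auto
        next
          case 2
          then have "(a - T u) * (\<alpha> - h u) \<le> b"
            unfolding b2 using J[OF uJ] by (intro mult_mono) auto
          then show ?thesis by (simp add: algebra_simps)
        qed
      qed (use b0 in simp)
      with True show ?thesis by (intro mult_right_mono) auto
    next
      case False
      have "b \<le> (T u - a) * (h u - \<alpha>)"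
        using nonpos_outside[OF u False[unfolded not_less]]
      proof (elim disjE)
        assume "\<forall>j\<in>S. 0 < Q j \<longrightarrow> p u < p j"
        then have "(a - \<tau>1) * (\<alpha> - \<eta>1) \<le> (a - T u) * (\<alpha> - h u)"
          using L[OF u] \<tau> \<alpha> by (intro mult_mono) (auto simp: J_def)
        then show ?thesis by (simp add: b2 algebra_simps)
      next
        assume "\<forall>j\<in>S. 0 < Q j \<longrightarrow> p j < p u"
        then show ?thesis
          unfolding b_def using U[OF u] \<tau> \<alpha> by (intro mult_mono) (auto simp: J_def)
      qed
      with False show ?thesis by (intro mult_right_mono_neg) auto
    qed
  qed
qed

lemma reflection: "unimodal_weight M S (\<lambda>u. - p u) (\<lambda>u. - T u) (\<lambda>u. 1 - h u) Q"
proof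
  show "AE u in M. u \<in> S" by (rule AE_S)
  show "- T u \<le> - T v" "1 - h u \<le> 1 - h v" if "u \<in> S" "v \<in> S" "- p u \<le> - p v" for u v
    using T_mono[of v u] h_mono[of v u] that by simp_all
  show "0 \<le> 1 - h u" "1 - h u \<le> 1" if "u \<in> S" for u
    using h_nonneg[OF that] h_le_1[OF that] by simp_all
  show "min (Q u) (Q w) \<le> Q v"
    if "u \<in> S" "v \<in> S" "w \<in> S" "- p u \<le> - p v" "- p v \<le> - p w" for u v w
    using Q_quasiconcave[of w v u] that by (simp add: min.commute)
qed (simp_all add: Q_mean TQ_mean)

text \<open>The hypotheses say that weighting \<open>T - a\<close> by \<open>h\<close> is at least as good as the constant weights \<open>0\<close> and
\<open>1\<close>. The first handles the case in which \<open>a\<close> is above \<open>T\<close> on \<open>{Q > 0}\<close>, the second its mirror image.\<close>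

theorem weighted_integral_nonpos:
  assumes upper: "0 \<le> (\<integral>u. (T u - a) * h u \<partial>M)"
    and lower: "(\<integral>u. (T u - a) * (1 - h u) \<partial>M) \<le> 0"
  shows "(\<integral>u. (T u - a) * h u * Q u \<partial>M) \<le> 0"
proof -
  interpret R: unimodal_weight M S "\<lambda>u. - p u" "\<lambda>u. - T u" "\<lambda>u. 1 - h u" Q
    by (rule reflection)
  have R_eq: "(\<integral>u. (- T u - (- a)) * (1 - h u) * Q u \<partial>M) = (\<integral>u. (T u - a) * h u * Q u \<partial>M)"
  proof -
    have "(- T u - (- a)) * (1 - h u) * Q u = (T u - a) * (h u - 1) * Q u" for u
      by algebra
    then show ?thesis using shift_integral(1)[of a 1] by presburger
  qed
  have "(\<integral>u. (- T u - (- a)) * (1 - h u) \<partial>M) = - (\<integral>u. (T u - a) * (1 - h u) \<partial>M)"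
    by (simp add: integral_minus[symmetric] algebra_simps del: integral_minus)
  then have lower': "0 \<le> (\<integral>u. (- T u - (- a)) * (1 - h u) \<partial>M)" using lower by simp
  consider "\<forall>u\<in>S. 0 < Q u \<longrightarrow> T u \<le> a" | "\<forall>u\<in>S. 0 < Q u \<longrightarrow> a \<le> T u"
    | i j where "i \<in> S" "0 < Q i" "T i < a" "j \<in> S" "0 < Q j" "a < T j"
    by (force simp: not_le)
  then show ?thesis
  proof cases
    case 1
    then show ?thesis using upper by (intro weighted_integral_nonpos_above) auto
  next
    case 2
    then have "(\<integral>u. (- T u - (- a)) * (1 - h u) * Q u \<partial>M) \<le> 0"
      using lower' by (intro R.weighted_integral_nonpos_above) auto
    then show ?thesis unfolding R_eq .
  next
    case 3
    note ij = \<open>i \<in> S\<close> \<open>0 < Q i\<close> \<open>T i < a\<close> \<open>j \<in> S\<close> \<open>0 < Q j\<close> \<open>a < T j\<close>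
    show ?thesis
    proof (cases "\<forall>u\<in>S. Q u \<le> 0 \<longrightarrow> (\<exists>j\<in>S. 0 < Q j \<and> p u \<le> p j)")
      case True
      then show ?thesis using ij by (intro weighted_integral_nonpos_no_upper[where j=i]) auto
    next
      case False
      then obtain r where r: "r \<in> S" "Q r \<le> 0" "\<And>j. j \<in> S \<Longrightarrow> 0 < Q j \<Longrightarrow> p j < p r"
        by (auto simp: not_le)
      show ?thesis
      proof (cases "\<forall>u\<in>S. Q u \<le> 0 \<longrightarrow> (\<exists>j\<in>S. 0 < Q j \<and> p j \<le> p u)")
        case True
        then show ?thesis
          unfolding R_eq[symmetric] using ij
          by (intro R.weighted_integral_nonpos_no_upper[where j=j]) auto
      next
        case False
        then obtain l where l: "l \<in> S" "Q l \<le> 0" "\<And>j. j \<in> S \<Longrightarrow> 0 < Q j \<Longrightarrow> p l < p j"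
          by (auto simp: not_le)
        show ?thesis
          by (rule weighted_integral_nonpos_inside[OF l(1,2) less_imp_le[OF l(3)] r(1,2)
                less_imp_le[OF r(3)] ij])
      qed
    qed
  qed
qed

end

section \<open>Convex order from hinge functions\<close>

lemma convex_on_UNIV_subgradient:
  fixes f :: "real \<Rightarrow> real"
  assumes "convex_on UNIV f"
  shows "\<exists>g. \<forall>x y. f x + g x * (y - x) \<le> f y"
proof (intro exI allI)
  show "f x + Inf ((\<lambda>t. (f x - f t) / (x - t)) ` ({x<..} \<inter> UNIV)) * (y - x) \<le> f y" for x y
    by (rule convex_le_Inf_differential[OF assms]) simp_all
qed

text \<open>A convex function on the line is approximated from below by the upper envelope of finitely many of
its tangents. If the points of contact increase, so do the slopes, each tangent overtakes its
predecessor exactly once, and the envelope equals the first tangent plus the sum of the positive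
parts of the successive differences. Each positive part is a multiple of a hinge function, so
inequalities for hinges extend to the envelope.\<close>

locale subgradient =
  fixes f g :: "real \<Rightarrow> real"
  assumes subgradient: "\<And>x y. f x + g x * (y - x) \<le> f y"
begin

definition tangent :: "real \<Rightarrow> real \<Rightarrow> real" where
  "tangent q x = f q + g q * (x - q)"

definition tangent_hull :: "(nat \<Rightarrow> real) \<Rightarrow> nat \<Rightarrow> real \<Rightarrow> real" where
  "tangent_hull q k x =
     tangent (q 0) x + (\<Sum>i<k. max 0 (tangent (q (Suc i)) x - tangent (q i) x))"

lemma subgradient_mono: "x \<le> y \<Longrightarrow> g x \<le> g y"
proof (cases "x = y")
  case False
  assume "x \<le> y"
  have "g x * (y - x) \<le> g y * (y - x)"
    using subgradient[of x y] subgradient[of y x] by (simp add: algebra_simps)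
  then show ?thesis using False \<open>x \<le> y\<close> by (simp add: mult_le_cancel_right)
qed simp

lemma tangent_le: "tangent q x \<le> f x"
  unfolding tangent_def by (rule subgradient)

lemma tangent_diff: "tangent q' x - tangent q x =
    (tangent q' y - tangent q y) + (g q' - g q) * (x - y)"
  by (simp add: tangent_def algebra_simps)

lemma tangent_self: "tangent q q = f q"
  by (simp add: tangent_def)

lemma tangent_hull_Suc: "tangent_hull q (Suc k) x =
    tangent_hull q k x + max 0 (tangent (q (Suc k)) x - tangent (q k) x)"
  by (simp add: tangent_hull_def)

text \<open>To the right of the last point of contact the last tangent is the largest one.\<close>

lemma tangent_hull_right:
  assumes q: "\<And>i. q i \<le> q (Suc i)" and "q k \<le> x"
  shows "tangent_hull q k x = tangent (q k) x"
  using assms(2)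
proof (induction k)
  case (Suc k)
  have "0 \<le> (tangent (q (Suc k)) (q (Suc k)) - tangent (q k) (q (Suc k)))
      + (g (q (Suc k)) - g (q k)) * (x - q (Suc k))"
    using Suc.prems tangent_le[of "q k" "q (Suc k)"] subgradient_mono[OF q]
    by (intro add_nonneg_nonneg mult_nonneg_nonneg) (simp_all add: tangent_self)
  then have "tangent (q k) x \<le> tangent (q (Suc k)) x"
    by (simp add: tangent_diff[symmetric])
  with Suc q[of k] show ?case by (simp add: tangent_hull_Suc)
qed (simp add: tangent_hull_def)

text \<open>Adding a tangent changes the sum only where the new tangent exceeds its predecessor. This happens
to the right of the predecessor's point of contact, where the previous sum is the predecessor
itself; so the new sum is again a tangent there.\<close>

lemma tangent_hull_le:
  assumes q: "\<And>i. q i \<le> q (Suc i)"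
  shows "tangent_hull q k x \<le> f x"
proof (induction k)
  case (Suc k)
  show ?case
  proof (cases "tangent (q (Suc k)) x \<le> tangent (q k) x")
    case False
    have "q k \<le> x"
    proof (rule ccontr)
      assume "\<not> q k \<le> x"
      then have "(tangent (q (Suc k)) (q k) - tangent (q k) (q k))
          + (g (q (Suc k)) - g (q k)) * (x - q k) \<le> 0"
        using tangent_le[of "q (Suc k)" "q k"] subgradient_mono[OF q]
        by (intro add_nonpos_nonpos mult_nonneg_nonpos) (simp_all add: tangent_self)
      with False show False by (simp add: tangent_diff[symmetric])
    qed
    then show ?thesis
      using False tangent_le[of "q (Suc k)" x]
      by (simp add: tangent_hull_Suc tangent_hull_right[where q=q, OF q])
  qed (simp add: tangent_hull_Suc Suc)
qed (simp add: tangent_hull_def tangent_le)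

lemma tangent_hull_ge:
  assumes "i \<le> k"
  shows "tangent (q i) x \<le> tangent_hull q k x"
proof -
  have "tangent (q i) x \<le> tangent_hull q i x"
    by (induction i) (auto simp: tangent_hull_Suc, simp add: tangent_hull_def)
  also have "\<dots> \<le> tangent_hull q k x"
    using assms by (induction k rule: dec_induct) (auto simp: tangent_hull_Suc)
  finally show ?thesis .
qed

text \<open>The points of contact fill \<open>[-(N + 1), N + 1]\<close> with spacing \<open>1 / (N + 1)\<close>. The point \<open>0\<close> is always among
them, so all approximations are bounded below by the same affine function.\<close>

definition grid :: "nat \<Rightarrow> nat \<Rightarrow> real" where
  "grid N i = - real (Suc N) + real i / real (Suc N)"

definition grid_hull :: "nat \<Rightarrow> real \<Rightarrow> real" where
  "grid_hull N = tangent_hull (grid N) (2 * (Suc N)\<^sup>2)"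

lemma grid_mono: "grid N i \<le> grid N (Suc i)"
  by (simp add: grid_def divide_right_mono)

lemma grid_hull_le: "grid_hull N x \<le> f x"
  unfolding grid_hull_def by (rule tangent_hull_le) (rule grid_mono)

lemma grid_hull_ge_tangent_0: "tangent 0 x \<le> grid_hull N x"
proof -
  have "grid N ((Suc N)\<^sup>2) = 0"
    by (simp add: grid_def power2_eq_square del: of_nat_Suc mult_Suc mult_Suc_right)
  then show ?thesis
    using tangent_hull_ge[of "(Suc N)\<^sup>2" "2 * (Suc N)\<^sup>2" "grid N" x] by (simp add: grid_hull_def)
qed

lemma grid_hull_error:
  assumes "\<bar>x\<bar> \<le> real N"
  shows "f x - grid_hull N x \<le> (g x - g (x - 1)) / real (Suc N)"
proof -
  define n where "n = real (Suc N)"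
  define i where "i = nat \<lfloor>(x + n) * n\<rfloor>"
  have n: "1 \<le> n" "\<bar>x\<bar> \<le> n" using assms by (auto simp: n_def)
  have pos: "0 \<le> (x + n) * n" using n by (intro mult_nonneg_nonneg) auto
  have i: "real i \<le> (x + n) * n" "(x + n) * n < real i + 1"
    using pos by (auto simp: i_def)
  have "real i \<le> (n + n) * n"
    using i(1) n mult_right_mono[of "x + n" "n + n" n] by linarith
  then have "real i \<le> real (2 * (Suc N)\<^sup>2)" by (simp add: n_def power2_eq_square algebra_simps)
  then have ile: "i \<le> 2 * (Suc N)\<^sup>2" by (simp only: of_nat_le_iff)
  define q where "q = grid N i"
  have qx: "q \<le> x" "x - q \<le> 1 / n"
  proof -
    have "q = real i / n - n" by (simp add: q_def grid_def n_def)
    moreover have "real i / n \<le> x + n" "x + n < (real i + 1) / n"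
      using i n by (simp_all add: pos_divide_le_eq pos_less_divide_eq)
    ultimately show "q \<le> x" "x - q \<le> 1 / n" by (simp_all add: add_divide_distrib)
  qed
  have q1: "x - 1 \<le> q" using qx(2) n order_trans[of "x - q" "1 / n" 1] by simp
  \<comment> \<open>The tangent at the grid point just below \<open>x\<close> already gives the error bound.\<close>
  have "f x - grid_hull N x \<le> f x - tangent q x"
    using tangent_hull_ge[OF ile, of "grid N" x] by (simp add: q_def grid_hull_def)
  also have "\<dots> \<le> (g x - g q) * (x - q)"
    using subgradient[of x q] by (simp add: tangent_def algebra_simps)
  also have "\<dots> \<le> (g x - g (x - 1)) * (1 / n)"
    using qx subgradient_mono[OF q1] subgradient_mono[OF qx(1)] by (intro mult_mono) auto
  finally show ?thesis by (simp add: n_def)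
qed

lemma grid_hull_tendsto: "(\<lambda>N. grid_hull N x) \<longlonglongrightarrow> f x"
proof (rule tendsto_sandwich)
  have "(\<lambda>N. f x - (g x - g (x - 1)) / real (Suc N)) \<longlonglongrightarrow> f x - 0"
    by (intro tendsto_intros LIMSEQ_Suc[OF lim_const_over_n])
  then show "(\<lambda>N. f x - (g x - g (x - 1)) / real (Suc N)) \<longlonglongrightarrow> f x" by simp
  show "\<forall>\<^sub>F N in sequentially. f x - (g x - g (x - 1)) / real (Suc N) \<le> grid_hull N x"
    using eventually_ge_at_top[of "nat \<lceil>\<bar>x\<bar>\<rceil>"]
  proof eventually_elim
    case (elim N)
    then have "\<bar>x\<bar> \<le> real N" by linarith
    from grid_hull_error[OF this] show ?case by simp
  qed
  show "\<forall>\<^sub>F N in sequentially. grid_hull N x \<le> f x"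
    by (simp add: grid_hull_le)
qed simp

end

text \<open>The hinge inequality compares the integrals of the tangent envelopes. These envelopes lie between the
tangent at \<open>0\<close> and the function itself, so the comparison passes to the limit by dominated convergence.\<close>

theorem convex_order_if_hinges:
  fixes \<alpha> \<beta> :: "real measure"
  assumes prob: "prob_space \<alpha>" "prob_space \<beta>"
    and sets: "sets \<alpha> = sets borel" "sets \<beta> = sets borel"
    and int: "integrable \<alpha> (\<lambda>x. x)" "integrable \<beta> (\<lambda>x. x)"
    and mean: "(\<integral>x. x \<partial>\<alpha>) = (\<integral>x. x \<partial>\<beta>)"
    and hinge: "\<And>a. (\<integral>x. max (x - a) 0 \<partial>\<alpha>) \<le> (\<integral>x. max (x - a) 0 \<partial>\<beta>)"
  shows "\<beta> \<ge>\<^sub>c\<^sub>x \<alpha>"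
proof -
  have [measurable_cong]: "sets \<alpha> = sets borel" "sets \<beta> = sets borel" by fact+
  interpret \<alpha>: prob_space \<alpha> by fact
  interpret \<beta>: prob_space \<beta> by fact
  have affine_hinge: "(\<integral>x. max 0 (c + d * x) \<partial>\<alpha>) \<le> (\<integral>x. max 0 (c + d * x) \<partial>\<beta>)"
    if "0 \<le> d" for c d
  proof (cases "d = 0")
    case True
    then show ?thesis by (simp add: \<alpha>.prob_space \<beta>.prob_space)
  next
    case False
    with that have d: "0 < d" by simp
    have "max 0 (c + d * x) = d * max (x - (- c / d)) 0" for x
      using d by (auto simp: max_def field_simps)
    then show ?thesis using hinge[of "- c / d"] d by simp
  qed
  have "(\<integral>x. f x \<partial>\<alpha>) \<le> (\<integral>x. f x \<partial>\<beta>)"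
    if f: "convex_on UNIV f" "integrable \<alpha> f" "integrable \<beta> f" for f
  proof -
    from convex_on_UNIV_subgradient[OF f(1)] obtain g
      where g: "\<forall>x y. f x + g x * (y - x) \<le> f y" ..
    interpret subgradient f g by unfold_locales (use g in blast)
    have tangent_eq: "tangent q x = (f q - g q * q) + g q * x" for q x
      by (simp add: tangent_def algebra_simps)
    have diff_eq: "tangent q' x - tangent q x
        = ((f q' - g q' * q') - (f q - g q * q)) + (g q' - g q) * x" for q q' x
      by (simp add: tangent_def algebra_simps)
    have int_hull: "integrable \<alpha> (tangent_hull q k)" "integrable \<beta> (tangent_hull q k)" for q k
      unfolding tangent_hull_def diff_eq tangent_eq using int by auto
    have hull: "(\<integral>x. tangent_hull q k x \<partial>\<alpha>) \<le> (\<integral>x. tangent_hull q k x \<partial>\<beta>)"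
      if "\<And>i. q i \<le> q (Suc i)" for q k
    proof -
      have "(\<integral>x. max 0 (tangent (q (Suc i)) x - tangent (q i) x) \<partial>\<alpha>)
          \<le> (\<integral>x. max 0 (tangent (q (Suc i)) x - tangent (q i) x) \<partial>\<beta>)" for i
        unfolding diff_eq using subgradient_mono[OF that] by (intro affine_hinge) simp
      moreover have "integrable \<alpha> (\<lambda>x. max 0 (tangent (q (Suc i)) x - tangent (q i) x))"
        "integrable \<beta> (\<lambda>x. max 0 (tangent (q (Suc i)) x - tangent (q i) x))" for i
        unfolding diff_eq using int by auto
      moreover have "integrable \<alpha> (tangent (q 0))" "integrable \<beta> (tangent (q 0))"
        "(\<integral>x. tangent (q 0) x \<partial>\<alpha>) = (\<integral>x. tangent (q 0) x \<partial>\<beta>)"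
        unfolding tangent_eq using int by (auto simp: \<alpha>.prob_space \<beta>.prob_space mean)
      ultimately show ?thesis
        unfolding tangent_hull_def by (simp add: sum_mono)
    qed
    have tangent_int: "integrable \<alpha> (tangent 0)" "integrable \<beta> (tangent 0)"
      unfolding tangent_eq using int by auto
    have dom: "\<bar>grid_hull N x\<bar> \<le> \<bar>f x\<bar> + \<bar>tangent 0 x\<bar>" for N x
      using grid_hull_le[of N x] grid_hull_ge_tangent_0[of x N] by auto
    have lim: "(\<lambda>N. \<integral>x. grid_hull N x \<partial>M) \<longlonglongrightarrow> (\<integral>x. f x \<partial>M)"
      if "integrable M f" "integrable M (tangent 0)" "\<And>N. integrable M (grid_hull N)" for M
      using that by (intro integral_dominated_convergence[where w="\<lambda>x. \<bar>f x\<bar> + \<bar>tangent 0 x\<bar>"])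
        (auto intro: grid_hull_tendsto dom)
    show ?thesis
    proof (rule LIMSEQ_le[OF lim[OF f(2) tangent_int(1)] lim[OF f(3) tangent_int(2)]])
      show "\<exists>K. \<forall>N\<ge>K. (\<integral>x. grid_hull N x \<partial>\<alpha>) \<le> (\<integral>x. grid_hull N x \<partial>\<beta>)"
        unfolding grid_hull_def by (intro exI[of _ 0] allI impI hull) (rule grid_mono)
    qed (simp_all add: grid_hull_def int_hull)
  qed
  then show ?thesis
    unfolding cx_ge_def using assms by blast
qed

section \<open>The exponential family\<close>

locale exponential_family = sigma_finite_measure \<nu> for \<nu> :: "real measure" +
  assumes sets_base [measurable_cong]: "sets \<nu> = sets borel"
    and base_nonzero: "emeasure \<nu> (space \<nu>) \<noteq> 0"
begin

abbreviation B :: "real \<Rightarrow> real" where "B \<equiv> cumulant \<nu>"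

abbreviation N :: "real set" where "N \<equiv> natural_params \<nu>"

lemma cumulant_measurable [measurable]: "B \<in> borel_measurable borel"
proof -
  have "(\<lambda>u. \<integral>x. exp (u * x) \<partial>\<nu>) \<in> borel_measurable borel"
    by (rule borel_measurable_lebesgue_integral) measurable
  then show ?thesis unfolding cumulant_def by measurable
qed

lemma lik_measurable [measurable]:
  "(\<lambda>(u, x). lik \<nu> u0 k u x) \<in> borel_measurable (borel \<Otimes>\<^sub>M borel)"
  unfolding lik_def by measurable

lemma exp_integrable: "u \<in> N \<Longrightarrow> integrable \<nu> (\<lambda>x. exp (u * x))"
  by (auto simp: natural_params_def integrable_iff_bounded)

lemma exp_cumulant:
  assumes "u \<in> N"
  shows "exp (B u) = (\<integral>x. exp (u * x) \<partial>\<nu>)"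
proof -
  have "(\<integral>x. exp (u * x) \<partial>\<nu>) \<noteq> 0"
  proof
    assume "(\<integral>x. exp (u * x) \<partial>\<nu>) = 0"
    then have "AE x in \<nu>. exp (u * x) = 0"
      using integral_nonneg_eq_0_iff_AE[OF exp_integrable[OF assms]] by simp
    then have "AE x in \<nu>. False" by simp
    then show False using base_nonzero by (simp add: AE_iff_null null_sets_def)
  qed
  moreover have "0 \<le> (\<integral>x. exp (u * x) \<partial>\<nu>)" by (rule integral_nonneg_AE) simp
  ultimately have "0 < (\<integral>x. exp (u * x) \<partial>\<nu>)" by (rule order.not_eq_order_implies_strict[OF not_sym])
  then show ?thesis by (simp add: cumulant_def)
qed

lemma normalized_exp:
  assumes "u \<in> N"
  shows "integrable \<nu> (\<lambda>x. exp (u * x - B u))" "(\<integral>x. exp (u * x - B u) \<partial>\<nu>) = 1"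
  using exp_integrable[OF assms] exp_cumulant[OF assms, symmetric] by (simp_all add: exp_diff)

text \<open>Hoelder's inequality in the form of the pointwise convexity of \<open>exp\<close>: both normalized exponentials
integrate to \<open>1\<close>.\<close>

lemma cumulant_convex:
  assumes "u \<in> N" "v \<in> N" "w \<in> N" "0 \<le> s" "s \<le> 1" "v = s * u + (1 - s) * w"
  shows "B v \<le> s * B u + (1 - s) * B w"
proof -
  have pointwise: "exp (v * x - (s * B u + (1 - s) * B w))
      \<le> s * exp (u * x - B u) + (1 - s) * exp (w * x - B w)" for x
  proof -
    have "v * x - (s * B u + (1 - s) * B w) = s * (u * x - B u) + (1 - s) * (w * x - B w)"
      by (simp add: assms(6) algebra_simps)
    then show ?thesis
      using convex_onD[OF exp_convex, where t="1 - s" and x="u * x - B u" and y="w * x - B w"] assms(4,5)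
      by simp
  qed
  have "exp (B v - (s * B u + (1 - s) * B w)) = (\<integral>x. exp (v * x - (s * B u + (1 - s) * B w)) \<partial>\<nu>)"
    using exp_integrable[OF assms(2)] exp_cumulant[OF assms(2)] by (simp add: exp_diff)
  also have "\<dots> \<le> (\<integral>x. s * exp (u * x - B u) + (1 - s) * exp (w * x - B w) \<partial>\<nu>)"
  proof (rule integral_mono)
    show "integrable \<nu> (\<lambda>x. exp (v * x - (s * B u + (1 - s) * B w)))"
      using exp_integrable[OF assms(2)] by (simp add: exp_diff)
    show "integrable \<nu> (\<lambda>x. s * exp (u * x - B u) + (1 - s) * exp (w * x - B w))"
      by (intro Bochner_Integration.integrable_add integrable_mult_right normalized_exp assms)
  qed (rule pointwise)
  also have "\<dots> = 1"
    using normalized_exp[OF assms(1)] normalized_exp[OF assms(3)] by simp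
  finally show ?thesis by simp
qed

lemma sets_expfam [simp, measurable_cong]: "sets (expfam \<nu> u) = sets borel"
  by (simp add: expfam_def sets_base)

lemma prob_space_expfam:
  assumes "u \<in> N"
  shows "prob_space (expfam \<nu> u)"
proof
  show "emeasure (expfam \<nu> u) (space (expfam \<nu> u)) = 1"
    using normalized_exp[OF assms]
    by (simp add: expfam_def emeasure_density nn_integral_eq_integral)
qed

lemma lik_nonneg [simp]: "0 \<le> lik \<nu> u0 k u x" and lik_pos [simp]: "0 < lik \<nu> u0 k u x"
  by (simp_all add: lik_def)

lemma expfam_eq_density:
  "expfam \<nu> u = density (expfam \<nu> u0) (\<lambda>x. ennreal (lik \<nu> u0 1 u x))"
proof -
  have "ennreal (exp (u0 * x - B u0)) * ennreal (lik \<nu> u0 1 u x) = ennreal (exp (u * x - B u))" for x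
    by (simp add: ennreal_mult[symmetric] lik_def exp_add[symmetric] algebra_simps)
  then show ?thesis
    unfolding expfam_def by (subst density_density_eq) simp_all
qed

text \<open>The likelihood ratio of an i.i.d. sample depends on the sample only through its sum. This is what
allows it to be pushed forward to the law of the sum.\<close>

lemma PiM_expfam_eq_density:
  assumes u: "u \<in> N" and u0: "u0 \<in> N"
  shows "PiM {..<k} (\<lambda>_. expfam \<nu> u) =
    density (PiM {..<k} (\<lambda>_. expfam \<nu> u0)) (\<lambda>\<omega>. ennreal (lik \<nu> u0 k u (\<Sum>i<k. \<omega> i)))"
proof -
  interpret U: prob_space "expfam \<nu> u" by (rule prob_space_expfam[OF u])
  interpret U0: prob_space "expfam \<nu> u0" by (rule prob_space_expfam[OF u0])
  interpret PU: product_sigma_finite "\<lambda>_::nat. expfam \<nu> u" by unfold_locales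
  interpret PU0: product_sigma_finite "\<lambda>_::nat. expfam \<nu> u0" by unfold_locales
  let ?P0 = "PiM {..<k} (\<lambda>_. expfam \<nu> u0)"
  have lik_prod: "ennreal (lik \<nu> u0 k u (\<Sum>i<k. \<omega> i)) = (\<Prod>i<k. ennreal (lik \<nu> u0 1 u (\<omega> i)))" for \<omega>
    by (simp add: prod_ennreal lik_def exp_sum[symmetric] sum_subtractf sum_distrib_left)
  have "density ?P0 (\<lambda>\<omega>. ennreal (lik \<nu> u0 k u (\<Sum>i<k. \<omega> i))) = PiM {..<k} (\<lambda>_. expfam \<nu> u)"
  proof (rule PU.PiM_eqI)
    show "sets (density ?P0 (\<lambda>\<omega>. ennreal (lik \<nu> u0 k u (\<Sum>i<k. \<omega> i))))
        = sets (PiM {..<k} (\<lambda>_. expfam \<nu> u))"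
      by (simp cong: sets_PiM_cong)
    fix A assume A: "\<And>i. i \<in> {..<k} \<Longrightarrow> A i \<in> sets (expfam \<nu> u)"
    then have A_borel [measurable]: "i < k \<Longrightarrow> A i \<in> sets borel" for i by simp
    have [measurable]: "Pi\<^sub>E {..<k} A \<in> sets ?P0"
      by (rule sets_PiM_I_finite) (use A in auto)
    have "emeasure (density ?P0 (\<lambda>\<omega>. ennreal (lik \<nu> u0 k u (\<Sum>i<k. \<omega> i)))) (Pi\<^sub>E {..<k} A)
        = (\<integral>\<^sup>+\<omega>. ennreal (lik \<nu> u0 k u (\<Sum>i<k. \<omega> i)) * indicator (Pi\<^sub>E {..<k} A) \<omega> \<partial>?P0)"
      by (rule emeasure_density) (measurable)
    also have "\<dots> = (\<integral>\<^sup>+\<omega>. (\<Prod>i<k. ennreal (lik \<nu> u0 1 u (\<omega> i)) * indicator (A i) (\<omega> i)) \<partial>?P0)"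
    proof (rule nn_integral_cong)
      fix \<omega> assume "\<omega> \<in> space ?P0"
      then have "indicator (Pi\<^sub>E {..<k} A) \<omega> = (\<Prod>i<k. indicator (A i) (\<omega> i) :: ennreal)"
        by (auto simp: space_PiM indicator_def PiE_iff split: if_splits)
      then show "ennreal (lik \<nu> u0 k u (\<Sum>i<k. \<omega> i)) * indicator (Pi\<^sub>E {..<k} A) \<omega>
          = (\<Prod>i<k. ennreal (lik \<nu> u0 1 u (\<omega> i)) * indicator (A i) (\<omega> i))"
        unfolding lik_prod prod.distrib by simp
    qed
    also have "\<dots> = (\<Prod>i<k. \<integral>\<^sup>+x. ennreal (lik \<nu> u0 1 u x) * indicator (A i) x \<partial>expfam \<nu> u0)"
      by (rule PU0.product_nn_integral_prod) (use A in auto)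
    also have "\<dots> = (\<Prod>i<k. emeasure (expfam \<nu> u) (A i))"
      using A by (intro prod.cong refl) (simp add: expfam_eq_density[of u u0] emeasure_density)
    finally show "emeasure (density ?P0 (\<lambda>\<omega>. ennreal (lik \<nu> u0 k u (\<Sum>i<k. \<omega> i)))) (Pi\<^sub>E {..<k} A)
        = (\<Prod>i<k. emeasure (expfam \<nu> u) (A i))" .
  qed simp
  then show ?thesis by simp
qed

lemma sets_expfam_sum [simp, measurable_cong]: "sets (expfam_sum \<nu> k u) = sets borel"
  and space_expfam_sum [simp]: "space (expfam_sum \<nu> k u) = UNIV"
  by (simp_all add: expfam_sum_def)

lemma prob_space_expfam_sum:
  assumes "u \<in> N"
  shows "prob_space (expfam_sum \<nu> k u)"
proof -
  interpret U: prob_space "expfam \<nu> u" by (rule prob_space_expfam[OF assms])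
  interpret PU: product_prob_space "\<lambda>_::nat. expfam \<nu> u" "{..<k}" by unfold_locales
  show ?thesis
    unfolding expfam_sum_def by (rule PU.prob_space_distr) measurable
qed

lemma expfam_sum_eq_density:
  assumes "u \<in> N" "u0 \<in> N"
  shows "expfam_sum \<nu> k u = density (expfam_sum \<nu> k u0) (\<lambda>x. ennreal (lik \<nu> u0 k u x))"
  unfolding expfam_sum_def PiM_expfam_eq_density[OF assms]
  by (rule density_distr[symmetric]) measurable

text \<open>The probability of \<open>A\<close> under the law of the sum of \<open>k\<close> observations, as a function of the parameter. It
is written through the likelihood ratio so that it is a measurable function of \<open>u\<close> on the whole
line; on the natural parameter set it agrees with the probability (\<open>event_prob_eq_measure\<close>).\<close>

definition event_prob :: "real \<Rightarrow> nat \<Rightarrow> real set \<Rightarrow> real \<Rightarrow> real" where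
  "event_prob u0 k A u = (\<integral>x. indicator A x * lik \<nu> u0 k u x \<partial>expfam_sum \<nu> k u0)"

lemma lik_integrable:
  assumes u: "u \<in> N" and u0: "u0 \<in> N" and A [measurable]: "A \<in> sets borel"
  shows "integrable (expfam_sum \<nu> k u0) (\<lambda>x. indicator A x * lik \<nu> u0 k u x)"
    and event_prob_eq_measure: "event_prob u0 k A u = measure (expfam_sum \<nu> k u) A"
proof -
  interpret U: prob_space "expfam_sum \<nu> k u" by (rule prob_space_expfam_sum[OF u])
  have "integrable (expfam_sum \<nu> k u) (indicat_real A)"
    by (rule integrable_real_indicator) (simp_all add: U.emeasure_finite less_top[symmetric])
  moreover have "(\<integral>x. indicator A x \<partial>expfam_sum \<nu> k u) = measure (expfam_sum \<nu> k u) A" by simp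
  moreover have "integrable (expfam_sum \<nu> k u) (indicat_real A)
      \<longleftrightarrow> integrable (expfam_sum \<nu> k u0) (\<lambda>x. indicator A x * lik \<nu> u0 k u x)"
    unfolding expfam_sum_eq_density[OF u u0] by (simp add: integrable_density mult.commute)
  moreover have "(\<integral>x. indicator A x \<partial>expfam_sum \<nu> k u) = event_prob u0 k A u"
    unfolding expfam_sum_eq_density[OF u u0] event_prob_def
    by (subst integral_density) (simp_all add: mult.commute)
  ultimately show "integrable (expfam_sum \<nu> k u0) (\<lambda>x. indicator A x * lik \<nu> u0 k u x)"
    "event_prob u0 k A u = measure (expfam_sum \<nu> k u) A"
    by simp_all
qed

lemma event_prob_bounds:
  assumes "u \<in> N" "u0 \<in> N" "A \<in> sets borel"
  shows "0 \<le> event_prob u0 k A u" "event_prob u0 k A u \<le> 1"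
proof -
  interpret U: prob_space "expfam_sum \<nu> k u" by (rule prob_space_expfam_sum[OF assms(1)])
  show "0 \<le> event_prob u0 k A u" "event_prob u0 k A u \<le> 1" by (simp_all add: event_prob_eq_measure assms)
qed

text \<open>The likelihood ratio of the larger parameter is non-decreasing in the observation, hence positively
correlated with the indicator of a set that is closed upwards.\<close>

lemma event_prob_mono:
  assumes u: "u \<in> N" and v: "v \<in> N" and u0: "u0 \<in> N" and "u \<le> v"
    and A [measurable]: "A \<in> sets borel" and up: "\<And>x y. x \<in> A \<Longrightarrow> x \<le> y \<Longrightarrow> y \<in> A"
  shows "event_prob u0 k A u \<le> event_prob u0 k A v"
proof -
  interpret U: prob_space "expfam_sum \<nu> k u" by (rule prob_space_expfam_sum[OF u])
  have int: "integrable (expfam_sum \<nu> k u) (\<lambda>x. indicator A x * lik \<nu> u k v x)"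
    and int1: "integrable (expfam_sum \<nu> k u) (\<lambda>x. lik \<nu> u k v x)"
    using lik_integrable[OF v u, of A] lik_integrable[OF v u, of UNIV] by simp_all
  have "U.expectation (indicator A) * U.expectation (lik \<nu> u k v)
      \<le> U.expectation (\<lambda>x. indicator A x * lik \<nu> u k v x)"
  proof (rule U.similarly_ordered_expectation_mult_le[where S=UNIV])
    show "integrable (expfam_sum \<nu> k u) (indicat_real A)"
      by (rule integrable_real_indicator) (simp_all add: U.emeasure_finite less_top[symmetric])
    have lik_mono: "lik \<nu> u k v x \<le> lik \<nu> u k v y" if "x \<le> y" for x y
      using that \<open>u \<le> v\<close> by (simp add: lik_def mult_left_mono)
    show "0 \<le> (indicat_real A x - indicat_real A y) * (lik \<nu> u k v x - lik \<nu> u k v y)" for x y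
      using up[of x y] up[of y x] lik_mono[of x y] lik_mono[of y x]
      by (cases "x \<le> y") (auto simp: indicator_def)
  qed (use int int1 in auto)
  moreover have "U.expectation (lik \<nu> u k v) = 1"
    using event_prob_eq_measure[OF v u, of UNIV k] prob_space.prob_space[OF prob_space_expfam_sum[OF v]]
    by (simp add: event_prob_def)
  moreover have "U.expectation (\<lambda>x. indicator A x * lik \<nu> u k v x) = event_prob u0 k A v"
    using event_prob_eq_measure[OF v u A, of k] event_prob_eq_measure[OF v u0 A, of k] by (simp add: event_prob_def)
  ultimately show ?thesis using event_prob_eq_measure[OF u u0 A, of k] by simp
qed

lemma event_prob_UNIV: "u \<in> N \<Longrightarrow> u0 \<in> N \<Longrightarrow> event_prob u0 k UNIV u = 1"
  using prob_space.prob_space[OF prob_space_expfam_sum[of u k]] by (simp add: event_prob_eq_measure)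

lemma event_prob_measurable:
  assumes u0: "u0 \<in> N" and [measurable]: "A \<in> sets borel"
  shows "event_prob u0 k A \<in> borel_measurable borel"
proof -
  interpret U0: prob_space "expfam_sum \<nu> k u0" by (rule prob_space_expfam_sum[OF u0])
  show ?thesis
    unfolding event_prob_def by (rule U0.borel_measurable_lebesgue_integral) measurable
qed

end

section \<open>Posterior distributions\<close>

lemma closed_msupport: "closed (msupport M)"
proof -
  have "open (- msupport M)"
  proof (subst open_subopen, intro ballI)
    fix x assume "x \<in> - msupport M"
    then obtain U where U: "open U" "x \<in> U" "\<not> 0 < emeasure M U"
      by (auto simp: msupport_def)
    then have "U \<subseteq> - msupport M" by (auto simp: msupport_def)
    with U show "\<exists>U. open U \<and> x \<in> U \<and> U \<subseteq> - msupport M" by blast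
  qed
  then show ?thesis by (simp add: closed_def)
qed

locale prior = exponential_family \<nu> for \<nu> :: "real measure" +
  fixes \<mu> :: "real measure" and T :: "real \<Rightarrow> real" and u0 :: real
  assumes prob_space_prior: "prob_space \<mu>"
    and sets_prior [measurable_cong]: "sets \<mu> = sets borel"
    and support_subset: "msupport \<mu> \<subseteq> N"
    and T_mono: "mono_on (msupport \<mu>) T"
    and T_set_integrable: "set_integrable \<mu> (msupport \<mu>) T"
    and T_nonconstant: "\<not> (\<exists>c. AE u in \<mu>. u \<in> msupport \<mu> \<longrightarrow> T u = c)"
    and u0_in_N: "u0 \<in> N"
begin

abbreviation S :: "real set" where "S \<equiv> msupport \<mu>"

text \<open>The extension of \<open>T\<close> by zero is measurable on the whole line.\<close>

definition TS :: "real \<Rightarrow> real" where "TS u = indicator S u * T u"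

lemma S_sets [measurable]: "S \<in> sets borel"
  by (rule borel_closed) (rule closed_msupport)

lemma TS_eq: "u \<in> S \<Longrightarrow> TS u = T u"
  by (simp add: TS_def)

lemma TS_measurable [measurable]: "TS \<in> borel_measurable borel"
proof -
  have "TS \<in> borel_measurable \<mu>"
    using borel_measurable_integrable[OF T_set_integrable[unfolded set_integrable_def]]
    by (simp add: TS_def[abs_def])
  then show ?thesis by (simp cong: measurable_cong_sets add: sets_prior)
qed

lemma tilt_measurable [measurable]: "tilt \<nu> t y \<in> borel_measurable borel"
  unfolding tilt_def by measurable

lemma tilt_pos [simp]: "0 < tilt \<nu> t y u" and tilt_nonneg [simp]: "0 \<le> tilt \<nu> t y u"
  by (simp_all add: tilt_def)

definition norm_const :: "real \<Rightarrow> real \<Rightarrow> real" where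
  "norm_const t y = (LINT v:S|\<mu>. tilt \<nu> t y v)"

definition weight :: "real \<Rightarrow> real \<Rightarrow> real \<Rightarrow> real" where
  "weight t y u = indicator S u * (tilt \<nu> t y u / norm_const t y)"

lemma weight_measurable [measurable]: "weight t y \<in> borel_measurable borel"
  unfolding weight_def by measurable

text \<open>The set \<open>S\<close> has positive mass, since otherwise \<open>T\<close> would be almost surely constant on it.\<close>

lemma not_AE_outside_S: "\<not> (AE u in \<mu>. u \<notin> S)"
proof
  assume "AE u in \<mu>. u \<notin> S"
  then have "AE u in \<mu>. u \<in> S \<longrightarrow> T u = 0" by eventually_elim simp
  with T_nonconstant show False by blast
qed

context
  fixes t y :: real
  assumes y: "y \<in> post_dom \<nu> \<mu> T t"
begin

lemma tilt_integrable:
  shows tilt_set_integrable: "integrable \<mu> (\<lambda>u. indicator S u * tilt \<nu> t y u)"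
    and T_tilt_integrable: "integrable \<mu> (\<lambda>u. TS u * tilt \<nu> t y u)"
proof -
  have fin: "(\<integral>\<^sup>+u. ennreal ((1 + \<bar>T u\<bar>) * tilt \<nu> t y u) * indicator S u \<partial>\<mu>) < \<infinity>"
    using y by (simp add: post_dom_def)
  have bound: "integrable \<mu> f" if [measurable]: "f \<in> borel_measurable borel"
    and le: "\<And>u. \<bar>f u\<bar> \<le> indicator S u * ((1 + \<bar>T u\<bar>) * tilt \<nu> t y u)" for f :: "real \<Rightarrow> real"
  proof (rule integrableI_bounded)
    have "(\<integral>\<^sup>+u. ennreal (norm (f u)) \<partial>\<mu>)
        \<le> (\<integral>\<^sup>+u. ennreal ((1 + \<bar>T u\<bar>) * tilt \<nu> t y u) * indicator S u \<partial>\<mu>)"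
    proof (rule nn_integral_mono)
      fix u show "ennreal (norm (f u)) \<le> ennreal ((1 + \<bar>T u\<bar>) * tilt \<nu> t y u) * indicator S u"
        using le[of u] by (cases "u \<in> S") (auto intro: ennreal_leI)
    qed
    also note fin
    finally show "(\<integral>\<^sup>+u. ennreal (norm (f u)) \<partial>\<mu>) < \<infinity>" .
  qed measurable
  show "integrable \<mu> (\<lambda>u. indicator S u * tilt \<nu> t y u)"
  proof (rule bound)
    show "\<bar>indicator S u * tilt \<nu> t y u\<bar> \<le> indicator S u * ((1 + \<bar>T u\<bar>) * tilt \<nu> t y u)" for u
      by (auto simp: indicator_def algebra_simps)
  qed measurable
  show "integrable \<mu> (\<lambda>u. TS u * tilt \<nu> t y u)"
  proof (rule bound)
    show "\<bar>TS u * tilt \<nu> t y u\<bar> \<le> indicator S u * ((1 + \<bar>T u\<bar>) * tilt \<nu> t y u)" for u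
      by (auto simp: indicator_def TS_def algebra_simps abs_mult)
  qed measurable
qed

lemma norm_const_pos: "0 < norm_const t y"
proof -
  have eq: "norm_const t y = (\<integral>u. indicator S u * tilt \<nu> t y u \<partial>\<mu>)"
    by (simp add: norm_const_def set_lebesgue_integral_def)
  have "norm_const t y \<noteq> 0"
  proof
    assume "norm_const t y = 0"
    then have "AE u in \<mu>. indicator S u * tilt \<nu> t y u = 0"
      using integral_nonneg_eq_0_iff_AE[OF tilt_set_integrable] eq by simp
    then have "AE u in \<mu>. u \<notin> S"
      by eventually_elim (auto simp: indicator_def tilt_def split: if_splits)
    with not_AE_outside_S show False by blast
  qed
  moreover have "0 \<le> norm_const t y" unfolding eq by (rule integral_nonneg_AE) simp
  ultimately show ?thesis by simp
qed

lemma weight_nonneg [simp]: "0 \<le> weight t y u"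
  using norm_const_pos by (simp add: weight_def)

lemma post_eq_density: "post \<nu> \<mu> t y = density \<mu> (\<lambda>u. ennreal (weight t y u))"
  unfolding post_def norm_const_def[symmetric] weight_def
  by (intro density_cong) (auto simp: indicator_def)

lemma sets_post [simp, measurable_cong]: "sets (post \<nu> \<mu> t y) = sets borel"
  by (simp add: post_eq_density sets_prior)

lemma prob_space_post: "prob_space (post \<nu> \<mu> t y)"
proof
  have "integrable \<mu> (weight t y)" "(\<integral>u. weight t y u \<partial>\<mu>) = 1"
    using tilt_set_integrable norm_const_pos
    by (simp_all add: weight_def[abs_def] norm_const_def set_lebesgue_integral_def)
  then show "emeasure (post \<nu> \<mu> t y) (space (post \<nu> \<mu> t y)) = 1"
    by (simp add: post_eq_density emeasure_density nn_integral_eq_integral)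
qed

lemma AE_post_iff: "(AE u in post \<nu> \<mu> t y. P u) \<longleftrightarrow> (AE u in \<mu>. u \<in> S \<longrightarrow> P u)"
proof -
  have "0 < weight t y u \<longleftrightarrow> u \<in> S" for u
    using norm_const_pos by (simp add: weight_def indicator_def)
  then show ?thesis
    unfolding post_eq_density by (subst AE_density) simp_all
qed

lemma AE_post_S: "AE u in post \<nu> \<mu> t y. u \<in> S"
  by (simp add: AE_post_iff)

lemma TS_integrable_post: "integrable (post \<nu> \<mu> t y) TS"
proof -
  have "weight t y u * TS u = TS u * tilt \<nu> t y u / norm_const t y" for u
    by (simp add: weight_def TS_def indicator_def)
  then show ?thesis
    unfolding post_eq_density using T_tilt_integrable by (simp add: integrable_density)
qed

lemma post_mean_eq: "post_mean \<nu> \<mu> T t y = (\<integral>u. TS u \<partial>post \<nu> \<mu> t y)"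
  by (simp add: post_mean_def set_lebesgue_integral_def TS_def[abs_def])

end

text \<open>The density of the posterior with parameters \<open>t'\<close>, \<open>y'\<close> with respect to the one with parameters
\<open>t\<close>, \<open>y\<close>; see \<open>post_change\<close>.\<close>

definition post_ratio :: "real \<Rightarrow> real \<Rightarrow> real \<Rightarrow> real \<Rightarrow> real \<Rightarrow> real" where
  "post_ratio t y t' y' u =
     norm_const t y / norm_const t' y' * exp (u * (y' - y) - (t' - t) * B u)"

lemma post_ratio_measurable [measurable]: "post_ratio t y t' y' \<in> borel_measurable borel"
  unfolding post_ratio_def by measurable

lemma post_change:
  assumes y: "y \<in> post_dom \<nu> \<mu> T t" and y': "y' \<in> post_dom \<nu> \<mu> T t'"
  shows "post \<nu> \<mu> t' y' = density (post \<nu> \<mu> t y) (\<lambda>u. ennreal (post_ratio t y t' y' u))"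
    and post_ratio_pos: "0 < post_ratio t y t' y' u"
proof -
  show pos: "0 < post_ratio t y t' y' u" for u
    using norm_const_pos[OF y] norm_const_pos[OF y'] by (simp add: post_ratio_def)
  have "weight t y u * post_ratio t y t' y' u = weight t' y' u" for u
    using norm_const_pos[OF y] norm_const_pos[OF y']
    by (simp add: weight_def post_ratio_def tilt_def exp_diff[symmetric] exp_add[symmetric] field_simps)
  then show "post \<nu> \<mu> t' y' = density (post \<nu> \<mu> t y) (\<lambda>u. ennreal (post_ratio t y t' y' u))"
    unfolding post_eq_density[OF y] post_eq_density[OF y']
    using weight_nonneg[OF y] less_imp_le[OF pos]
    by (subst density_density_eq) (simp_all add: ennreal_mult[symmetric])
qed

lemma post_change_integral:
  assumes y: "y \<in> post_dom \<nu> \<mu> T t" and y': "y' \<in> post_dom \<nu> \<mu> T t'"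
    and [measurable]: "f \<in> borel_measurable borel"
  shows "integrable (post \<nu> \<mu> t' y') f \<longleftrightarrow>
      integrable (post \<nu> \<mu> t y) (\<lambda>u. f u * post_ratio t y t' y' u)"
    and "(\<integral>u. f u \<partial>post \<nu> \<mu> t' y') = (\<integral>u. f u * post_ratio t y t' y' u \<partial>post \<nu> \<mu> t y)"
proof -
  have [measurable_cong]: "sets (post \<nu> \<mu> t y) = sets borel" by (rule sets_post[OF y])
  have nn: "AE u in post \<nu> \<mu> t y. 0 \<le> post_ratio t y t' y' u"
    using post_ratio_pos[OF y y'] by (simp add: less_imp_le)
  show "integrable (post \<nu> \<mu> t' y') f \<longleftrightarrow>
      integrable (post \<nu> \<mu> t y) (\<lambda>u. f u * post_ratio t y t' y' u)"
    unfolding post_change[OF y y'] using nn by (subst integrable_density) (simp_all add: mult.commute)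
  show "(\<integral>u. f u \<partial>post \<nu> \<mu> t' y') = (\<integral>u. f u * post_ratio t y t' y' u \<partial>post \<nu> \<mu> t y)"
    unfolding post_change[OF y y'] using nn by (subst integral_density) (simp_all add: mult.commute)
qed

lemma TS_mono: "u \<in> S \<Longrightarrow> v \<in> S \<Longrightarrow> u \<le> v \<Longrightarrow> TS u \<le> TS v"
  using T_mono by (simp add: TS_eq mono_on_def)

text \<open>Raising \<open>y\<close> tilts the posterior by an increasing exponential, which is positively correlated with \<open>T\<close>.
Equal means would be the case of equality in the association inequality, and then \<open>T\<close> would be
almost surely constant.\<close>

lemma post_mean_neq:
  assumes y: "y \<in> post_dom \<nu> \<mu> T t" and y': "y' \<in> post_dom \<nu> \<mu> T t" and "y < y'"
  shows "post_mean \<nu> \<mu> T t y \<noteq> post_mean \<nu> \<mu> T t y'"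
proof
  assume eq: "post_mean \<nu> \<mu> T t y = post_mean \<nu> \<mu> T t y'"
  interpret P: prob_space "post \<nu> \<mu> t y" by (rule prob_space_post[OF y])
  interpret P': prob_space "post \<nu> \<mu> t y'" by (rule prob_space_post[OF y'])
  let ?R = "post_ratio t y t y'"
  have R_less: "?R u < ?R v" if "u < v" for u v
    using norm_const_pos[OF y] norm_const_pos[OF y'] that \<open>y < y'\<close>
    by (simp add: post_ratio_def divide_strict_right_mono)
  have R: "integrable (post \<nu> \<mu> t y) ?R" "P.expectation ?R = 1"
    using post_change_integral[OF y y', of "\<lambda>_. 1"] P'.prob_space by simp_all
  have TR: "integrable (post \<nu> \<mu> t y) (\<lambda>u. TS u * ?R u)"
    "P.expectation (\<lambda>u. TS u * ?R u) = P.expectation TS"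
    using post_change_integral[OF y y', of TS] TS_integrable_post[OF y'] eq
    by (simp_all add: post_mean_eq[OF y] post_mean_eq[OF y'])
  have "\<exists>u\<in>S. AE v in post \<nu> \<mu> t y. (TS u - TS v) * (?R u - ?R v) = 0"
  proof (rule P.similarly_ordered_expectation_mult_eq)
    show "0 \<le> (TS u - TS v) * (?R u - ?R v)" if "u \<in> S" "v \<in> S" for u v
      using TS_mono[of u v] TS_mono[of v u] R_less[of u v] R_less[of v u] that
      by (cases u v rule: linorder_cases) (auto intro: mult_nonpos_nonpos)
  qed (use AE_post_S[OF y] TS_integrable_post[OF y] R TR in simp_all)
  then obtain u where u: "u \<in> S" "AE v in \<mu>. v \<in> S \<longrightarrow> (TS u - TS v) * (?R u - ?R v) = 0"
    unfolding AE_post_iff[OF y] by blast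
  from u(2) have "AE v in \<mu>. v \<in> S \<longrightarrow> T v = T u"
  proof eventually_elim
    case (elim v)
    show ?case
      using elim u(1) R_less[of u v] R_less[of v u]
      by (cases u v rule: linorder_cases) (auto simp: TS_eq)
  qed
  then show False using T_nonconstant by blast
qed

lemma post_stat:
  assumes "z \<in> post_range \<nu> \<mu> T t"
  shows "post_stat \<nu> \<mu> T t z \<in> post_dom \<nu> \<mu> T t"
    and "post_mean \<nu> \<mu> T t (post_stat \<nu> \<mu> T t z) = z"
proof -
  obtain y where y: "y \<in> post_dom \<nu> \<mu> T t" "post_mean \<nu> \<mu> T t y = z"
    using assms by (auto simp: post_range_def)
  have "\<exists>!y. y \<in> post_dom \<nu> \<mu> T t \<and> post_mean \<nu> \<mu> T t y = z"
  proof (rule ex1I[of _ y])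
    fix y' assume y': "y' \<in> post_dom \<nu> \<mu> T t \<and> post_mean \<nu> \<mu> T t y' = z"
    show "y' = y"
      using post_mean_neq[of y t y'] post_mean_neq[of y' t y] y y'
      by (cases y y' rule: linorder_cases) auto
  qed (use y in simp)
  from theI'[OF this] show "post_stat \<nu> \<mu> T t z \<in> post_dom \<nu> \<mu> T t"
    "post_mean \<nu> \<mu> T t (post_stat \<nu> \<mu> T t z) = z"
    unfolding post_stat_def by simp_all
qed

end

section \<open>The one-step kernel\<close>

locale posterior_update = prior \<nu> \<mu> T u0 for \<nu> \<mu> :: "real measure" and T :: "real \<Rightarrow> real" and u0 :: real +
  fixes t :: real and k :: nat and z :: real
  assumes z_range: "z \<in> post_range \<nu> \<mu> T t"
begin

abbreviation \<pi> :: "real measure" where "\<pi> \<equiv> post_at \<nu> \<mu> T t z"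

abbreviation P0 :: "real measure" where "P0 \<equiv> expfam_sum \<nu> k u0"

abbreviation L :: "real \<Rightarrow> real \<Rightarrow> real" where "L \<equiv> lik \<nu> u0 k"

lemma stat_dom: "post_stat \<nu> \<mu> T t z \<in> post_dom \<nu> \<mu> T t"
  by (rule post_stat(1)[OF z_range])

lemma sets_\<pi> [simp, measurable_cong]: "sets \<pi> = sets borel"
  unfolding post_at_def by (rule sets_post[OF stat_dom])

lemma space_\<pi> [simp]: "space \<pi> = UNIV"
  using sets_eq_imp_space_eq[OF sets_\<pi>] by simp

lemma prob_space_\<pi>: "prob_space \<pi>"
  unfolding post_at_def by (rule prob_space_post[OF stat_dom])

lemma AE_\<pi>: "AE u in \<pi>. u \<in> S"
  unfolding post_at_def by (rule AE_post_S[OF stat_dom])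

lemma TS_integrable: "integrable \<pi> TS"
  unfolding post_at_def by (rule TS_integrable_post[OF stat_dom])

lemma TS_supported: "indicator S u * TS u = TS u"
  by (simp add: TS_def indicator_def)

lemma TS_mean: "(\<integral>u. TS u \<partial>\<pi>) = z"
  using post_stat(2)[OF z_range] by (simp add: post_at_def post_mean_eq[OF stat_dom])

sublocale \<pi>: prob_space \<pi> by (rule prob_space_\<pi>)

sublocale P0: prob_space P0 by (rule prob_space_expfam_sum[OF u0_in_N])

sublocale joint: pair_sigma_finite \<pi> P0 ..

text \<open>With \<open>f = 1\<close> and \<open>f = T\<close> these are the integrands of the predictive density and of the numerator of the
updated mean, as functions on the product space on which Fubini's theorem is applied. The
indicator of \<open>S\<close> confines \<open>u\<close> to parameters at which the likelihood integrates to \<open>1\<close>.\<close>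

definition joint_density :: "(real \<Rightarrow> real) \<Rightarrow> real set \<Rightarrow> real \<times> real \<Rightarrow> real" where
  "joint_density f A = (\<lambda>(u, x). indicator S u * f u * (indicator A x * L u x))"

lemma joint_density_measurable [measurable]:
  assumes [measurable]: "f \<in> borel_measurable borel" "A \<in> sets borel"
  shows "joint_density f A \<in> borel_measurable (borel \<Otimes>\<^sub>M borel)"
  unfolding joint_density_def by measurable

lemma joint_inner:
  assumes "A \<in> sets borel"
  shows "integrable P0 (\<lambda>x. joint_density f A (u, x))"
    and "(\<integral>x. joint_density f A (u, x) \<partial>P0) = indicator S u * f u * event_prob u0 k A u"
    and "(\<integral>x. norm (joint_density f A (u, x)) \<partial>P0) = indicator S u * \<bar>f u\<bar> * event_prob u0 k A u"
proof -
  show "integrable P0 (\<lambda>x. joint_density f A (u, x))"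
  proof (cases "u \<in> S")
    case True
    then show ?thesis
      using lik_integrable[OF _ u0_in_N assms, of u k] support_subset
      by (auto simp: joint_density_def)
  qed (simp add: joint_density_def)
  have "norm (joint_density f A (u, x)) = indicator S u * \<bar>f u\<bar> * (indicator A x * L u x)" for x
    by (simp add: joint_density_def abs_mult)
  then show "(\<integral>x. norm (joint_density f A (u, x)) \<partial>P0) = indicator S u * \<bar>f u\<bar> * event_prob u0 k A u"
    by (simp add: event_prob_def)
  show "(\<integral>x. joint_density f A (u, x) \<partial>P0) = indicator S u * f u * event_prob u0 k A u"
    by (simp add: joint_density_def event_prob_def)
qed

lemma joint_integrable:
  assumes f [measurable]: "f \<in> borel_measurable borel" and int: "integrable \<pi> f"
    and A [measurable]: "A \<in> sets borel"
  shows "integrable (\<pi> \<Otimes>\<^sub>M P0) (joint_density f A)"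
proof (rule joint.Fubini_integrable)
  show "integrable \<pi> (\<lambda>u. \<integral>x. norm (joint_density f A (u, x)) \<partial>P0)"
    unfolding joint_inner(3)[OF A]
  proof (rule Bochner_Integration.integrable_bound[OF int])
    show "(\<lambda>u. indicator S u * \<bar>f u\<bar> * event_prob u0 k A u) \<in> borel_measurable \<pi>"
      using event_prob_measurable[OF u0_in_N A, of k] by measurable
    have "norm (indicator S u * \<bar>f u\<bar> * event_prob u0 k A u) \<le> norm (f u)" for u
      using event_prob_bounds[OF _ u0_in_N A, of u k] support_subset
      by (auto simp: indicator_def abs_mult intro!: mult_left_le)
    then show "AE u in \<pi>. norm (indicator S u * \<bar>f u\<bar> * event_prob u0 k A u) \<le> norm (f u)" by simp
  qed
qed (auto intro: joint_inner(1)[OF A])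

lemma joint_integral:
  assumes "f \<in> borel_measurable borel" "integrable \<pi> f" and A: "A \<in> sets borel"
  shows "(\<integral>x. (\<integral>u. joint_density f A (u, x) \<partial>\<pi>) \<partial>P0) = (\<integral>u. f u * event_prob u0 k A u \<partial>\<pi>)"
    and "integrable P0 (\<lambda>x. \<integral>u. joint_density f A (u, x) \<partial>\<pi>)"
    and "AE x in P0. integrable \<pi> (\<lambda>u. joint_density f A (u, x))"
proof -
  have int: "integrable (\<pi> \<Otimes>\<^sub>M P0) (\<lambda>(u, x). joint_density f A (u, x))"
    using joint_integrable[OF assms] by simp
  have "(\<integral>x. (\<integral>u. joint_density f A (u, x) \<partial>\<pi>) \<partial>P0)
      = (\<integral>u. (\<integral>x. joint_density f A (u, x) \<partial>P0) \<partial>\<pi>)"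
    by (rule joint.Fubini_integral[OF int])
  also have "\<dots> = (\<integral>u. f u * event_prob u0 k A u \<partial>\<pi>)"
    unfolding joint_inner(2)[OF A]
  proof (rule integral_cong_AE)
    show "AE u in \<pi>. indicator S u * f u * event_prob u0 k A u = f u * event_prob u0 k A u"
      using AE_\<pi> by eventually_elim simp
  qed (use assms(1) event_prob_measurable[OF u0_in_N A, of k] in measurable)
  finally show "(\<integral>x. (\<integral>u. joint_density f A (u, x) \<partial>\<pi>) \<partial>P0) = (\<integral>u. f u * event_prob u0 k A u \<partial>\<pi>)" .
  show "integrable P0 (\<lambda>x. \<integral>u. joint_density f A (u, x) \<partial>\<pi>)"
    by (rule joint.integrable_snd[OF int])
  show "AE x in P0. integrable \<pi> (\<lambda>u. joint_density f A (u, x))"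
    by (rule joint.AE_integrable_snd[OF int])
qed

text \<open>The updated mean at \<open>x\<close> is \<open>\<tau> x / r x\<close>, where \<open>r\<close> is the predictive density, at all \<open>x\<close> in the set \<open>G\<close>
below. This set has full measure and carries the regular branch of the definition of the updated mean.\<close>

definition r :: "real \<Rightarrow> real" where "r x = (\<integral>u. indicator S u * L u x \<partial>\<pi>)"

definition \<tau> :: "real \<Rightarrow> real" where "\<tau> x = (\<integral>u. TS u * L u x \<partial>\<pi>)"

definition G :: "real set" where
  "G = {x. integrable \<pi> (\<lambda>u. indicator S u * L u x) \<and> integrable \<pi> (\<lambda>u. TS u * L u x)}"

lemma r_measurable [measurable]: "r \<in> borel_measurable borel"
  and \<tau>_measurable [measurable]: "\<tau> \<in> borel_measurable borel"
  unfolding r_def[abs_def] \<tau>_def[abs_def]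
  by (rule \<pi>.borel_measurable_lebesgue_integral; measurable)+

lemma r_nonneg: "0 \<le> r x"
  unfolding r_def by (rule integral_nonneg_AE) simp

lemma joint_density_1: "(\<integral>u. joint_density (\<lambda>_. 1) A (u, x) \<partial>\<pi>) = indicator A x * r x"
proof -
  have "(\<integral>u. joint_density (\<lambda>_. 1) A (u, x) \<partial>\<pi>)
      = (\<integral>u. indicator A x * (indicator S u * L u x) \<partial>\<pi>)"
    by (simp add: joint_density_def mult_ac)
  then show ?thesis by (simp add: r_def)
qed

lemma joint_density_TS: "(\<integral>u. joint_density TS A (u, x) \<partial>\<pi>) = indicator A x * \<tau> x"
proof -
  have "(\<integral>u. joint_density TS A (u, x) \<partial>\<pi>) = (\<integral>u. indicator A x * (TS u * L u x) \<partial>\<pi>)"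
    by (simp add: joint_density_def TS_supported mult_ac)
  then show ?thesis by (simp add: \<tau>_def)
qed

lemma AE_G: "AE x in P0. x \<in> G"
proof -
  have "AE x in P0. integrable \<pi> (\<lambda>u. joint_density (\<lambda>_. 1) UNIV (u, x))"
    "AE x in P0. integrable \<pi> (\<lambda>u. joint_density TS UNIV (u, x))"
    using TS_integrable by (auto intro!: joint_integral(3))
  then show ?thesis
    by eventually_elim (simp add: G_def joint_density_def TS_supported)
qed

lemma r_integrals:
  assumes "A \<in> sets borel"
  shows "integrable P0 (\<lambda>x. indicator A x * r x)"
    and "(\<integral>x. indicator A x * r x \<partial>P0) = (\<integral>u. event_prob u0 k A u \<partial>\<pi>)"
  using joint_integral[of "\<lambda>_. 1" A] assms by (simp_all add: joint_density_1)

lemma \<tau>_integrals: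
  assumes "A \<in> sets borel"
  shows "integrable P0 (\<lambda>x. indicator A x * \<tau> x)"
    and "(\<integral>x. indicator A x * \<tau> x \<partial>P0) = (\<integral>u. TS u * event_prob u0 k A u \<partial>\<pi>)"
  using joint_integral[of TS A] assms TS_integrable by (simp_all add: joint_density_TS)

lemma r_pos:
  assumes "x \<in> G"
  shows "0 < r x"
proof -
  have "r x \<noteq> 0"
  proof
    assume "r x = 0"
    then have "AE u in \<pi>. indicator S u * L u x = 0"
      using assms integral_nonneg_eq_0_iff_AE[of \<pi> "\<lambda>u. indicator S u * L u x"]
      by (simp add: G_def r_def)
    with AE_\<pi> have "AE u in \<pi>. False"
      by eventually_elim (simp add: lik_def)
    then show False by simp
  qed
  with r_nonneg[of x] show ?thesis by simp
qed

lemma rho_eq: "rho \<nu> \<mu> T u0 t k z x = (\<integral>\<^sup>+u. ennreal (indicator S u * L u x) \<partial>\<pi>)"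
  unfolding rho_def by (intro nn_integral_cong) (simp add: indicator_def)

lemma eta_eq: "eta \<nu> \<mu> T u0 t k z x = (\<integral>\<^sup>+u. ennreal \<bar>TS u * L u x\<bar> \<partial>\<pi>)"
  unfolding eta_def by (intro nn_integral_cong) (simp add: indicator_def TS_def abs_mult)

lemma \<tau>_eq: "(LINT u:S|\<pi>. T u * L u x) = \<tau> x"
  by (simp add: set_lebesgue_integral_def \<tau>_def TS_def mult.assoc)

lemma upd_mean_G:
  assumes "x \<in> G"
  shows "upd_mean \<nu> \<mu> T u0 t k z x = \<tau> x / r x"
proof -
  have int: "integrable \<pi> (\<lambda>u. indicator S u * L u x)" "integrable \<pi> (\<lambda>u. TS u * L u x)"
    using assms by (auto simp: G_def)
  have "rho \<nu> \<mu> T u0 t k z x = ennreal (r x)"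
    unfolding rho_eq r_def by (rule nn_integral_eq_integral[OF int(1)]) simp
  moreover have "eta \<nu> \<mu> T u0 t k z x < \<infinity>"
    using int(2) unfolding eta_eq by (simp add: integrable_iff_bounded)
  ultimately show ?thesis
    using r_pos[OF assms] by (simp add: upd_mean_def \<tau>_eq)
qed

lemma upd_mean_measurable [measurable]: "upd_mean \<nu> \<mu> T u0 t k z \<in> borel_measurable borel"
proof -
  have [measurable]: "rho \<nu> \<mu> T u0 t k z \<in> borel_measurable borel"
    unfolding rho_eq[abs_def] by (rule \<pi>.borel_measurable_nn_integral) measurable
  have [measurable]: "eta \<nu> \<mu> T u0 t k z \<in> borel_measurable borel"
    unfolding eta_eq[abs_def] by (rule \<pi>.borel_measurable_nn_integral) measurable
  show ?thesis unfolding upd_mean_def[abs_def] \<tau>_eq by measurable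
qed

lemma predictive_eq_density: "predictive \<nu> \<mu> T t k z = density P0 (\<lambda>x. ennreal (r x))"
proof -
  let ?R = "restrict_space \<pi> S"
  have S_\<pi>: "S \<inter> space \<pi> \<in> sets \<pi>" by simp
  have space_R: "space ?R = S" by (simp add: space_restrict_space)
  have "S \<noteq> {}" using not_AE_outside_S by auto
  have kernel: "expfam_sum \<nu> k \<in> measurable ?R (subprob_algebra borel)"
  proof (rule measurable_subprob_algebra)
    fix u assume "u \<in> space ?R"
    then have u: "u \<in> N" using support_subset by (auto simp: space_R)
    show "subprob_space (expfam_sum \<nu> k u)"
      by (rule prob_space_imp_subprob_space) (rule prob_space_expfam_sum[OF u])
  next
    fix A :: "real set" assume A: "A \<in> sets borel"
    have "(\<lambda>u. ennreal (event_prob u0 k A u)) \<in> borel_measurable ?R"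
      using event_prob_measurable[OF u0_in_N A, of k]
      by (intro measurable_restrict_space1 measurable_compose[OF _ measurable_ennreal]) simp
    moreover have "emeasure (expfam_sum \<nu> k u) A = ennreal (event_prob u0 k A u)" if "u \<in> space ?R" for u
    proof -
      have u: "u \<in> N" using support_subset that by (auto simp: space_R)
      interpret prob_space "expfam_sum \<nu> k u" by (rule prob_space_expfam_sum[OF u])
      show ?thesis by (simp add: event_prob_eq_measure[OF u u0_in_N A] emeasure_eq_measure)
    qed
    ultimately show "(\<lambda>u. emeasure (expfam_sum \<nu> k u) A) \<in> borel_measurable ?R"
      by (subst measurable_cong[where g="\<lambda>u. ennreal (event_prob u0 k A u)"]) simp_all
  qed simp
  show ?thesis
  proof (rule measure_eqI)
    show sets: "sets (predictive \<nu> \<mu> T t k z) = sets (density P0 (\<lambda>x. ennreal (r x)))"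
      using \<open>S \<noteq> {}\<close> unfolding predictive_def by (subst sets_bind[of _ _ borel]) (simp_all add: space_R)
    fix A assume "A \<in> sets (predictive \<nu> \<mu> T t k z)"
    then have A [measurable]: "A \<in> sets borel" using sets by simp
    have "emeasure (predictive \<nu> \<mu> T t k z) A = (\<integral>\<^sup>+u. emeasure (expfam_sum \<nu> k u) A \<partial>?R)"
      unfolding predictive_def
      by (rule emeasure_bind[OF _ kernel A]) (simp add: space_R \<open>S \<noteq> {}\<close>)
    also have "\<dots> = (\<integral>\<^sup>+u. emeasure (expfam_sum \<nu> k u) A * indicator S u \<partial>\<pi>)"
      by (rule nn_integral_restrict_space[OF S_\<pi>])
    also have "\<dots> = (\<integral>\<^sup>+u. ennreal (event_prob u0 k A u) \<partial>\<pi>)"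
    proof (rule nn_integral_cong_AE)
      show "AE u in \<pi>. emeasure (expfam_sum \<nu> k u) A * indicator S u = ennreal (event_prob u0 k A u)"
        using AE_\<pi>
      proof eventually_elim
        case (elim u)
        then have u: "u \<in> N" using support_subset by auto
        interpret prob_space "expfam_sum \<nu> k u" by (rule prob_space_expfam_sum[OF u])
        show ?case using elim by (simp add: event_prob_eq_measure[OF u u0_in_N A] emeasure_eq_measure)
      qed
    qed
    also have "\<dots> = ennreal (\<integral>u. event_prob u0 k A u \<partial>\<pi>)"
    proof (rule nn_integral_eq_integral)
      have bounds: "AE u in \<pi>. 0 \<le> event_prob u0 k A u \<and> event_prob u0 k A u \<le> 1"
        using AE_\<pi> by eventually_elim (use event_prob_bounds[OF _ u0_in_N A] support_subset in auto)
      then show "AE u in \<pi>. 0 \<le> event_prob u0 k A u" by eventually_elim simp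
      show "integrable \<pi> (event_prob u0 k A)"
      proof (rule \<pi>.integrable_const_bound[where B=1])
        show "AE u in \<pi>. norm (event_prob u0 k A u) \<le> 1" using bounds by eventually_elim simp
      qed (use event_prob_measurable[OF u0_in_N A, of k] in measurable)
    qed
    also have "\<dots> = ennreal (\<integral>x. indicator A x * r x \<partial>P0)"
      by (simp add: r_integrals(2)[OF A])
    also have "\<dots> = (\<integral>\<^sup>+x. ennreal (indicator A x * r x) \<partial>P0)"
      by (rule nn_integral_eq_integral[symmetric, OF r_integrals(1)[OF A]]) (simp add: r_nonneg)
    also have "\<dots> = emeasure (density P0 (\<lambda>x. ennreal (r x))) A"
      by (subst emeasure_density) (auto intro!: nn_integral_cong simp: indicator_def)
    finally show "emeasure (predictive \<nu> \<mu> T t k z) A = emeasure (density P0 (\<lambda>x. ennreal (r x))) A" .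
  qed
qed

abbreviation K :: "real measure" where "K \<equiv> trans_kernel \<nu> \<mu> T u0 t k z"

lemma sets_K [simp, measurable_cong]: "sets K = sets borel"
  by (simp add: trans_kernel_def)

lemma prob_space_K: "prob_space K"
proof -
  have "emeasure (predictive \<nu> \<mu> T t k z) UNIV = 1"
  proof -
    have "emeasure (predictive \<nu> \<mu> T t k z) UNIV = (\<integral>\<^sup>+x. ennreal (indicator UNIV x * r x) \<partial>P0)"
      by (simp add: predictive_eq_density emeasure_density)
    also have "\<dots> = ennreal (\<integral>x. indicator UNIV x * r x \<partial>P0)"
      by (rule nn_integral_eq_integral[OF r_integrals(1)]) (simp_all add: r_nonneg)
    also have "(\<integral>x. indicator UNIV x * r x \<partial>P0) = (\<integral>u. event_prob u0 k UNIV u \<partial>\<pi>)"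
      by (rule r_integrals(2)) simp
    also have "\<dots> = (\<integral>u. 1 \<partial>\<pi>)"
    proof (rule integral_cong_AE)
      show "AE u in \<pi>. event_prob u0 k UNIV u = 1"
        using AE_\<pi> by eventually_elim (use event_prob_UNIV[OF _ u0_in_N] support_subset in auto)
    qed (use event_prob_measurable[OF u0_in_N, of UNIV k] in measurable)
    finally show ?thesis using \<pi>.prob_space by simp
  qed
  then have "prob_space (predictive \<nu> \<mu> T t k z)"
    by (intro prob_spaceI) (simp add: predictive_eq_density)
  then show ?thesis
    unfolding trans_kernel_def by (rule prob_space.prob_space_distr) (simp add: predictive_eq_density)
qed

text \<open>Integrals under the kernel are integrals under the reference law \<open>P0\<close> with density \<open>r\<close>, and there
the updated mean may be replaced by \<open>\<tau> / r\<close>.\<close>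

lemma K_integral:
  assumes [measurable]: "f \<in> borel_measurable borel" "g \<in> borel_measurable borel"
    and g: "\<And>x. x \<in> G \<Longrightarrow> r x * f (\<tau> x / r x) = g x"
  shows "integrable K f \<longleftrightarrow> integrable P0 g" and "(\<integral>x. f x \<partial>K) = (\<integral>x. g x \<partial>P0)"
proof -
  have AE: "AE x in P0. r x * f (upd_mean \<nu> \<mu> T u0 t k z x) = g x"
    using AE_G by eventually_elim (simp add: upd_mean_G g)
  have "integrable K f \<longleftrightarrow> integrable P0 (\<lambda>x. r x * f (upd_mean \<nu> \<mu> T u0 t k z x))"
    unfolding trans_kernel_def predictive_eq_density
    by (subst integrable_distr_eq) (simp_all add: integrable_density r_nonneg)
  also have "\<dots> \<longleftrightarrow> integrable P0 g"
    by (rule integrable_cong_AE) (use AE in measurable)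
  finally show "integrable K f \<longleftrightarrow> integrable P0 g" .
  have "(\<integral>x. f x \<partial>K) = (\<integral>x. r x * f (upd_mean \<nu> \<mu> T u0 t k z x) \<partial>P0)"
    unfolding trans_kernel_def predictive_eq_density
    by (subst integral_distr) (simp_all add: integral_density r_nonneg)
  also have "\<dots> = (\<integral>x. g x \<partial>P0)"
    by (rule integral_cong_AE) (use AE in measurable)
  finally show "(\<integral>x. f x \<partial>K) = (\<integral>x. g x \<partial>P0)" .
qed

lemma K_mean: "integrable K (\<lambda>x. x)" "(\<integral>x. x \<partial>K) = z"
proof -
  have eq: "r x * (\<tau> x / r x) = \<tau> x" if "x \<in> G" for x using r_pos[OF that] by simp
  have "integrable P0 \<tau>" "(\<integral>x. \<tau> x \<partial>P0) = (\<integral>u. TS u * event_prob u0 k UNIV u \<partial>\<pi>)"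
    using \<tau>_integrals[of UNIV] by simp_all
  moreover have "(\<integral>u. TS u * event_prob u0 k UNIV u \<partial>\<pi>) = (\<integral>u. TS u \<partial>\<pi>)"
  proof (rule integral_cong_AE)
    show "AE u in \<pi>. TS u * event_prob u0 k UNIV u = TS u"
      using AE_\<pi> by eventually_elim (use event_prob_UNIV[OF _ u0_in_N] support_subset in auto)
  qed (use event_prob_measurable[OF u0_in_N, of UNIV k] in measurable)
  ultimately show "integrable K (\<lambda>x. x)" "(\<integral>x. x \<partial>K) = z"
    using K_integral[of "\<lambda>x. x" \<tau>] eq by (simp_all add: TS_mean)
qed

text \<open>The positive factor \<open>r\<close> is absorbed into the positive part.\<close>

lemma K_hinge: "(\<integral>x. max (x - a) 0 \<partial>K) = (\<integral>x. max (\<tau> x - a * r x) 0 \<partial>P0)"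
proof (rule K_integral(2))
  fix x assume "x \<in> G"
  from r_pos[OF this] show "r x * max (\<tau> x / r x - a) 0 = max (\<tau> x - a * r x) 0"
    by (simp add: max_mult_distrib_left right_diff_distrib mult.commute)
qed measurable

lemma gain_integrable:
  assumes "A \<in> sets borel"
  shows "integrable P0 (\<lambda>x. indicator A x * (\<tau> x - a * r x))"
proof -
  have "integrable P0 (\<lambda>x. indicator A x * \<tau> x - a * (indicator A x * r x))"
    using r_integrals(1)[OF assms] \<tau>_integrals(1)[OF assms] by simp
  then show ?thesis by (simp add: algebra_simps)
qed

lemma gain_integral:
  assumes A: "A \<in> sets borel"
  shows "(\<integral>x. indicator A x * (\<tau> x - a * r x) \<partial>P0) = (\<integral>u. (TS u - a) * event_prob u0 k A u \<partial>\<pi>)"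
proof -
  have event_prob_le: "AE u in \<pi>. norm (f u * event_prob u0 k A u) \<le> norm (f u)" for f :: "real \<Rightarrow> real"
    using AE_\<pi> by eventually_elim
      (use event_prob_bounds[OF _ u0_in_N A] support_subset in \<open>auto simp: abs_mult intro!: mult_left_le\<close>)
  have int: "integrable \<pi> (\<lambda>u. f u * event_prob u0 k A u)" if "integrable \<pi> f" for f
    using event_prob_measurable[OF u0_in_N A, of k] borel_measurable_integrable[OF that]
    by (intro Bochner_Integration.integrable_bound[OF that _ event_prob_le] borel_measurable_times) simp_all
  have "(\<integral>x. indicator A x * (\<tau> x - a * r x) \<partial>P0)
      = (\<integral>x. indicator A x * \<tau> x - a * (indicator A x * r x) \<partial>P0)"
    by (simp add: algebra_simps)
  also have "\<dots> = (\<integral>u. TS u * event_prob u0 k A u \<partial>\<pi>) - a * (\<integral>u. event_prob u0 k A u \<partial>\<pi>)"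
    using r_integrals[OF A] \<tau>_integrals[OF A] by simp
  also have "\<dots> = (\<integral>u. (TS u - a) * event_prob u0 k A u \<partial>\<pi>)"
    using int[OF TS_integrable] int[of "\<lambda>_. 1"] by (simp add: left_diff_distrib)
  finally show ?thesis .
qed

lemma hinge_integrable: "integrable P0 (\<lambda>x. max (\<tau> x - a * r x) 0)"
  using gain_integrable[of UNIV a] by simp

text \<open>Restricting \<open>\<tau> - a r\<close> to a set never gives more than its positive part.\<close>

lemma K_hinge_ge:
  assumes A: "A \<in> sets borel"
  shows "(\<integral>u. (TS u - a) * event_prob u0 k A u \<partial>\<pi>) \<le> (\<integral>x. max (x - a) 0 \<partial>K)"
  unfolding K_hinge gain_integral[OF A, symmetric]
  by (rule integral_mono[OF gain_integrable[OF A] hinge_integrable]) (auto simp: indicator_def)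

lemma K_hinge_ge_0: "0 \<le> (\<integral>x. max (x - a) 0 \<partial>K)"
  by (rule integral_nonneg_AE) simp

lemma K_hinge_ge_mean: "z - a \<le> (\<integral>x. max (x - a) 0 \<partial>K)"
proof -
  interpret K: prob_space K by (rule prob_space_K)
  have "z - a = (\<integral>x. x - a \<partial>K)" using K_mean by (simp add: K.prob_space)
  also have "\<dots> \<le> (\<integral>x. max (x - a) 0 \<partial>K)"
    using K_mean by (intro integral_mono) auto
  finally show ?thesis .
qed

text \<open>Passing from \<open>x\<close> to a larger \<open>y\<close> multiplies the updated posterior by an increasing exponential in the
parameter, which is positively correlated with \<open>T\<close>.\<close>

lemma updated_mean_mono:
  assumes x: "x \<in> G" and y: "y \<in> G" and "x \<le> y"
  shows "\<tau> x / r x \<le> \<tau> y / r y"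
proof -
  define D where "D = density \<pi> (\<lambda>u. ennreal (indicator S u * L u x / r x))"
  have rx: "0 < r x" and ry: "0 < r y" using r_pos x y by auto
  define g where "g u = exp ((u - u0) * (y - x))" for u
  have [measurable]: "(\<lambda>u. L u x) \<in> borel_measurable borel" for x unfolding lik_def by measurable
  have [measurable]: "g \<in> borel_measurable borel" unfolding g_def by measurable
  have [measurable_cong]: "sets D = sets borel" by (simp add: D_def)
  have nn: "0 \<le> indicator S u * L u x / r x" for u using rx by simp
  have D_int: "integrable D f \<longleftrightarrow> integrable \<pi> h" "(\<integral>u. f u \<partial>D) = (\<integral>u. h u \<partial>\<pi>) / r x"
    if [measurable]: "f \<in> borel_measurable borel" and h: "\<And>u. indicator S u * L u x * f u = h u" for f h
  proof -
    have "integrable \<pi> (\<lambda>u. h u / r x) \<longleftrightarrow> integrable \<pi> h"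
    proof
      assume "integrable \<pi> (\<lambda>u. h u / r x)"
      then have "integrable \<pi> (\<lambda>u. r x * (h u / r x))" by (rule integrable_mult_right)
      then show "integrable \<pi> h" using rx by simp
    qed simp
    then show "integrable D f \<longleftrightarrow> integrable \<pi> h"
      unfolding D_def using rx nn by (subst integrable_density) (simp_all add: h)
    show "(\<integral>u. f u \<partial>D) = (\<integral>u. h u \<partial>\<pi>) / r x"
      unfolding D_def using rx nn by (subst integral_density) (simp_all add: h)
  qed
  have shift: "L u x * g u = L u y" for u
    by (simp add: lik_def g_def exp_add[symmetric] algebra_simps)
  interpret D: prob_space D
  proof
    have "emeasure D (space D) = (\<integral>\<^sup>+u. ennreal (indicator S u * L u x / r x) \<partial>\<pi>)"
      by (simp add: D_def emeasure_density)
    also have "\<dots> = ennreal (\<integral>u. indicator S u * L u x / r x \<partial>\<pi>)"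
      using x nn by (intro nn_integral_eq_integral) (auto simp: G_def)
    finally show "emeasure D (space D) = 1" using rx by (simp add: r_def[symmetric])
  qed
  have "indicator S u * L u x * TS u = TS u * L u x" for u
    using TS_supported[of u] by (metis mult.assoc mult.commute)
  then have T: "integrable D TS" "D.expectation TS = \<tau> x / r x"
    using D_int[of TS "\<lambda>u. TS u * L u x"] x by (simp_all add: G_def \<tau>_def)
  have g: "integrable D g" "D.expectation g = r y / r x"
    using D_int[of g "\<lambda>u. indicator S u * L u y"] y shift by (simp_all add: G_def r_def mult_ac)
  have "indicator S u * L u x * (TS u * g u) = TS u * L u y" for u
  proof -
    have "indicator S u * L u x * (TS u * g u) = (indicator S u * TS u) * (L u x * g u)" by simp
    then show ?thesis unfolding TS_supported shift .
  qed
  then have Tg: "integrable D (\<lambda>u. TS u * g u)" "D.expectation (\<lambda>u. TS u * g u) = \<tau> y / r x"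
    using D_int[of "\<lambda>u. TS u * g u" "\<lambda>u. TS u * L u y"] y by (simp_all add: G_def \<tau>_def)
  have "D.expectation TS * D.expectation g \<le> D.expectation (\<lambda>u. TS u * g u)"
  proof (rule D.similarly_ordered_expectation_mult_le[where S=S])
    show "AE u in D. u \<in> S" unfolding D_def by (subst AE_density) (auto simp: indicator_def)
    have g_mono: "g u \<le> g v" if "u \<le> v" for u v
      using that \<open>x \<le> y\<close> by (simp add: g_def mult_right_mono)
    show "0 \<le> (TS u - TS v) * (g u - g v)" if "u \<in> S" "v \<in> S" for u v
      using TS_mono[of u v] TS_mono[of v u] g_mono[of u v] g_mono[of v u] that
      by (cases "u \<le> v") (auto intro: mult_nonpos_nonpos)
  qed (use T g Tg in simp_all)
  then have "\<tau> x / r x * r y \<le> \<tau> y"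
    using rx by (simp add: T g Tg divide_right_mono pos_divide_le_eq)
  then show ?thesis using ry by (simp add: pos_le_divide_eq)
qed

text \<open>The positive part is attained on the set where \<open>\<tau> / r > a\<close>. Only on \<open>G\<close> is the ratio known to be
monotone, so the set is replaced by its upward closure, which changes it by a null set.\<close>

lemma K_hinge_attained:
  obtains A where "A \<in> sets borel" "\<And>x y. x \<in> A \<Longrightarrow> x \<le> y \<Longrightarrow> y \<in> A"
    "(\<integral>x. max (x - a) 0 \<partial>K) = (\<integral>u. (TS u - a) * event_prob u0 k A u \<partial>\<pi>)"
proof -
  define A where "A = {y. \<exists>x\<in>G. a < \<tau> x / r x \<and> x \<le> y}"
  have up: "\<And>x y. x \<in> A \<Longrightarrow> x \<le> y \<Longrightarrow> y \<in> A" by (auto simp: A_def intro: order_trans)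
  then have "is_interval A" unfolding is_interval_1 by blast
  then have A: "A \<in> sets borel" by (rule real_interval_borel_measurable)
  have A_iff: "x \<in> A \<longleftrightarrow> a < \<tau> x / r x" if "x \<in> G" for x
    using updated_mean_mono[OF _ that] that by (fastforce simp: A_def)
  have "AE x in P0. max (\<tau> x - a * r x) 0 = indicator A x * (\<tau> x - a * r x)"
    using AE_G
  proof eventually_elim
    case (elim x)
    then show ?case
      using A_iff[of x] r_pos[of x] by (auto simp: indicator_def pos_less_divide_eq)
  qed
  then have "(\<integral>x. max (\<tau> x - a * r x) 0 \<partial>P0) = (\<integral>x. indicator A x * (\<tau> x - a * r x) \<partial>P0)"
    by (rule integral_cong_AE[rotated 2]) (use A in measurable)
  then show thesis
    using that[OF A up] by (simp add: K_hinge gain_integral[OF A])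
qed

end

section \<open>Comparison of two times\<close>

context prior
begin

text \<open>The exponent is affine plus a non-negative multiple of the convex cumulant function.\<close>

lemma likelihood_exponent_quasiconvex:
  assumes "0 \<le> s" and S: "u \<in> S" "v \<in> S" "w \<in> S" and le: "u \<le> v" "v \<le> w"
  shows "v * d + s * B v \<le> max (u * d + s * B u) (w * d + s * B w)"
proof (cases "u = w")
  case False
  define c where "c = (w - v) / (w - u)"
  have uw: "u < w" using le False by simp
  have c: "0 \<le> c" "c \<le> 1" using le uw by (auto simp: c_def)
  have "c * (w - u) = w - v" using uw by (simp add: c_def)
  then have v: "v = c * u + (1 - c) * w" by (simp add: algebra_simps)
  have "B v \<le> c * B u + (1 - c) * B w"
    using S support_subset c v by (intro cumulant_convex) auto
  then have "v * d + s * B v \<le> (c * u + (1 - c) * w) * d + s * (c * B u + (1 - c) * B w)"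
    using \<open>0 \<le> s\<close> v by (intro add_mono mult_left_mono) auto
  also have "\<dots> = c * (u * d + s * B u) + (1 - c) * (w * d + s * B w)"
    by (simp add: algebra_simps)
  also have "\<dots> \<le> c * max (u * d + s * B u) (w * d + s * B w)
      + (1 - c) * max (u * d + s * B u) (w * d + s * B w)"
    using c by (intro add_mono mult_left_mono) auto
  finally show ?thesis by (simp add: algebra_simps)
qed (use le in auto)

text \<open>The half-line that is optimal at the later time is used at both times. At the earlier time it gives
a lower bound for the hinge integral; the two values differ by an integral against \<open>Q\<close>, whose sign
is given by \<open>weighted_integral_nonpos\<close>.\<close>

theorem hinge_antimono:
  assumes z: "z \<in> post_range \<nu> \<mu> T t" "z \<in> post_range \<nu> \<mu> T t'" and "t \<le> t'"
  shows "(\<integral>x. max (x - a) 0 \<partial>trans_kernel \<nu> \<mu> T u0 t' k z)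
    \<le> (\<integral>x. max (x - a) 0 \<partial>trans_kernel \<nu> \<mu> T u0 t k z)"
proof -
  interpret early: posterior_update \<nu> \<mu> T u0 t k z by unfold_locales (rule z)
  interpret late: posterior_update \<nu> \<mu> T u0 t' k z by unfold_locales (rule z)
  let ?y = "post_stat \<nu> \<mu> T t z" and ?y' = "post_stat \<nu> \<mu> T t' z"
  define Q where "Q u = 1 - post_ratio t' ?y' t ?y u" for u
  obtain A where A: "A \<in> sets borel" "\<And>x y. x \<in> A \<Longrightarrow> x \<le> y \<Longrightarrow> y \<in> A"
    and attained: "(\<integral>x. max (x - a) 0 \<partial>late.K) = (\<integral>u. (TS u - a) * event_prob u0 k A u \<partial>late.\<pi>)"
    using late.K_hinge_attained[of a] by blast
  let ?h = "event_prob u0 k A"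
  have h [measurable]: "?h \<in> borel_measurable borel" by (rule event_prob_measurable[OF u0_in_N A(1)])
  have change: "integrable early.\<pi> f \<longleftrightarrow> integrable late.\<pi> (\<lambda>u. f u * (1 - Q u))"
    "(\<integral>u. f u \<partial>early.\<pi>) = (\<integral>u. f u * (1 - Q u) \<partial>late.\<pi>)"
    if "f \<in> borel_measurable borel" for f :: "real \<Rightarrow> real"
    using post_change_integral[OF late.stat_dom early.stat_dom that]
    by (simp_all add: post_at_def Q_def)
  have Q_int: "integrable late.\<pi> Q" and Q_mean: "(\<integral>u. Q u \<partial>late.\<pi>) = 0"
  proof -
    have *: "integrable late.\<pi> (\<lambda>u. 1 - Q u)" "(\<integral>u. 1 - Q u \<partial>late.\<pi>) = 1"
      using change[of "\<lambda>_. 1"] early.\<pi>.prob_space by simp_all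
    have "integrable late.\<pi> (\<lambda>u. 1 - (1 - Q u))"
      by (rule Bochner_Integration.integrable_diff[OF _ *(1)]) simp
    moreover have "(\<integral>u. 1 - (1 - Q u) \<partial>late.\<pi>) = (\<integral>u. 1 \<partial>late.\<pi>) - (\<integral>u. 1 - Q u \<partial>late.\<pi>)"
      by (rule Bochner_Integration.integral_diff[OF _ *(1)]) simp
    ultimately show "integrable late.\<pi> Q" "(\<integral>u. Q u \<partial>late.\<pi>) = 0"
      using *(2) late.\<pi>.prob_space by simp_all
  qed
  have TQ_int: "integrable late.\<pi> (\<lambda>u. TS u * Q u)" and TQ_mean: "(\<integral>u. TS u * Q u \<partial>late.\<pi>) = 0"
  proof -
    have "integrable late.\<pi> (\<lambda>u. TS u * (1 - Q u))" "(\<integral>u. TS u * (1 - Q u) \<partial>late.\<pi>) = z"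
      using change[of TS] early.TS_integrable early.TS_mean by simp_all
    then have "integrable late.\<pi> (\<lambda>u. TS u - TS u * (1 - Q u))"
      "(\<integral>u. TS u - TS u * (1 - Q u) \<partial>late.\<pi>) = 0"
      using late.TS_integrable late.TS_mean by simp_all
    then show "integrable late.\<pi> (\<lambda>u. TS u * Q u)" "(\<integral>u. TS u * Q u \<partial>late.\<pi>) = 0"
      by (simp_all add: algebra_simps)
  qed
  interpret W: unimodal_weight late.\<pi> S "\<lambda>u. u" TS ?h Q
  proof
    show "AE u in late.\<pi>. u \<in> S" by (rule late.AE_\<pi>)
    show "TS u \<le> TS v" if "u \<in> S" "v \<in> S" "u \<le> v" for u v using that by (rule TS_mono)
    show "?h u \<le> ?h v" if "u \<in> S" "v \<in> S" "u \<le> v" for u v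
      using that support_subset A by (intro event_prob_mono) (auto simp: u0_in_N)
    show "0 \<le> ?h u" "?h u \<le> 1" if "u \<in> S" for u
      using event_prob_bounds[OF _ u0_in_N A(1)] support_subset that by auto
    show "min (Q u) (Q w) \<le> Q v"
      if "u \<in> S" "v \<in> S" "w \<in> S" "u \<le> v" "v \<le> w" for u v w
    proof -
      define e where "e u = u * (?y - ?y') + (t' - t) * B u" for u
      define C where "C = norm_const t' ?y' / norm_const t ?y"
      have C: "0 < C" unfolding C_def by (intro divide_pos_pos norm_const_pos early.stat_dom late.stat_dom)
      have Q_eq: "Q u = 1 - C * exp (e u)" for u
        by (simp add: Q_def post_ratio_def C_def e_def algebra_simps)
      have "e v \<le> max (e u) (e w)"
        unfolding e_def using that \<open>t \<le> t'\<close> by (intro likelihood_exponent_quasiconvex) auto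
      then have "e v \<le> e u \<or> e v \<le> e w" by (simp add: le_max_iff_disj)
      then have "Q u \<le> Q v \<or> Q w \<le> Q v" using C by (auto simp: Q_eq)
      then show ?thesis by (simp add: min_le_iff_disj)
    qed
    show "?h \<in> borel_measurable late.\<pi>" by measurable
  qed (use late.TS_integrable Q_int Q_mean TQ_int TQ_mean in simp_all)
  \<comment> \<open>Optimality of \<open>A\<close> against the empty set and against the whole line.\<close>
  have upper: "0 \<le> (\<integral>u. (TS u - a) * ?h u \<partial>late.\<pi>)"
    using late.K_hinge_ge_0[of a] attained by simp
  have lower: "(\<integral>u. (TS u - a) * (1 - ?h u) \<partial>late.\<pi>) \<le> 0"
  proof -
    have "(TS u - a) * (1 - ?h u) = (TS u - a) - (TS u - a) * ?h u" for u
      by (simp add: algebra_simps)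
    then have "(\<integral>u. (TS u - a) * (1 - ?h u) \<partial>late.\<pi>)
        = (\<integral>u. TS u - a \<partial>late.\<pi>) - (\<integral>u. (TS u - a) * ?h u \<partial>late.\<pi>)"
      using W.shift_integral(3)[of a] late.TS_integrable by simp
    also have "(\<integral>u. TS u - a \<partial>late.\<pi>) = z - a"
      using late.TS_integrable late.TS_mean late.\<pi>.prob_space by simp
    finally show ?thesis using late.K_hinge_ge_mean[of a] attained by simp
  qed
  have "(\<integral>u. (TS u - a) * ?h u \<partial>late.\<pi>) - (\<integral>u. (TS u - a) * ?h u * Q u \<partial>late.\<pi>)
      = (\<integral>u. (TS u - a) * ?h u - (TS u - a) * ?h u * Q u \<partial>late.\<pi>)"
    using W.shift_integral(2)[of a 0] W.shift_integral(3)[of a] by simp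
  also have "\<dots> = (\<integral>u. (TS u - a) * ?h u * (1 - Q u) \<partial>late.\<pi>)"
    by (simp add: right_diff_distrib)
  also have "\<dots> = (\<integral>u. (TS u - a) * ?h u \<partial>early.\<pi>)"
    by (rule change(2)[symmetric]) measurable
  also have "\<dots> \<le> (\<integral>x. max (x - a) 0 \<partial>early.K)"
    by (rule early.K_hinge_ge[OF A(1)])
  finally show ?thesis
    using W.weighted_integral_nonpos[OF upper lower] attained by linarith
qed

theorem trans_kernel_convex_order:
  assumes z: "z \<in> post_range \<nu> \<mu> T t" "z \<in> post_range \<nu> \<mu> T t'" and "t \<le> t'"
  shows "trans_kernel \<nu> \<mu> T u0 t k z \<ge>\<^sub>c\<^sub>x trans_kernel \<nu> \<mu> T u0 t' k z"
proof -
  interpret early: posterior_update \<nu> \<mu> T u0 t k z by unfold_locales (rule z)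
  interpret late: posterior_update \<nu> \<mu> T u0 t' k z by unfold_locales (rule z)
  show ?thesis
    by (rule convex_order_if_hinges)
      (simp_all add: early.prob_space_K late.prob_space_K early.K_mean late.K_mean hinge_antimono[OF assms])
qed

end

theorem theorem3p1:
  fixes \<nu> \<mu> :: "real measure" and T :: "real \<Rightarrow> real" and u0 z y1 y2 :: real and m n k :: nat
  assumes "sigma_finite_measure \<nu>" and "sets \<nu> = sets borel"
    and nondegenerate: "\<And>u. u \<in> interior (natural_params \<nu>) \<Longrightarrow>
          0 < prob_space.variance (expfam \<nu> u) (\<lambda>x. x)"
    and "prob_space \<mu>" and "sets \<mu> = sets borel"
    and "msupport \<mu> \<subseteq> interior (natural_params \<nu>)"
    and "mono_on (msupport \<mu>) T"
    and "set_integrable \<mu> (msupport \<mu>) T"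
    and "\<not> (\<exists>c. AE u in \<mu>. u \<in> msupport \<mu> \<longrightarrow> T u = c)"
    and "u0 \<in> interior (natural_params \<nu>)"
    and "m < n" and "k \<ge> 1"
    and "z \<in> post_range \<nu> \<mu> T (real m) \<inter> post_range \<nu> \<mu> T (real n)"
    and "y1 < y2"
    and "\<And>r. r \<in> {real m..real n} \<Longrightarrow>
          \<exists>y\<in>post_dom \<nu> \<mu> T r. post_mean \<nu> \<mu> T r y = z \<and> y \<in> {y1<..<y2}"
    and "\<And>t y. t \<in> {real m, real n} \<Longrightarrow> y \<in> {y1, y2} \<Longrightarrow>
          (\<integral>\<^sup>+u\<in>msupport \<mu>. ennreal ((1 + \<bar>T u\<bar>) * (1 + \<bar>u\<bar> + \<bar>cumulant \<nu> u\<bar>) * tilt \<nu> t y u) \<partial>\<mu>)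
            < \<infinity>"
  shows "trans_kernel \<nu> \<mu> T u0 (real m) k z \<ge>\<^sub>c\<^sub>x trans_kernel \<nu> \<mu> T u0 (real n) k z"
proof -
  \<comment> \<open>If \<open>\<nu>\<close> were the zero measure, all variances would vanish.\<close>
  have nonzero: "emeasure \<nu> (space \<nu>) \<noteq> 0"
  proof
    assume zero: "emeasure \<nu> (space \<nu>) = 0"
    have "AE x in \<nu>. False"
      by (rule AE_I'[of "space \<nu>"]) (auto simp: null_sets_def zero)
    moreover have "(\<lambda>x. ennreal (exp (u0 * x - cumulant \<nu> u0))) \<in> borel_measurable \<nu>"
      using \<open>sets \<nu> = sets borel\<close> by (simp cong: measurable_cong_sets)
    ultimately have "AE x in expfam \<nu> u0. (x - (\<integral>y. y \<partial>expfam \<nu> u0))\<^sup>2 = 0"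
      unfolding expfam_def by (subst AE_density) (auto elim: eventually_mono)
    then have "(\<integral>x. (x - (\<integral>y. y \<partial>expfam \<nu> u0))\<^sup>2 \<partial>expfam \<nu> u0) = 0"
      by (rule integral_eq_zero_AE)
    with nondegenerate[OF \<open>u0 \<in> interior (natural_params \<nu>)\<close>] show False by simp
  qed
  interpret sigma_finite_measure \<nu> by fact
  interpret \<mu>: prob_space \<mu> by fact
  interpret prior \<nu> \<mu> T u0
  proof
    show "msupport \<mu> \<subseteq> natural_params \<nu>" "u0 \<in> natural_params \<nu>"
      using \<open>msupport \<mu> \<subseteq> interior (natural_params \<nu>)\<close> \<open>u0 \<in> interior (natural_params \<nu>)\<close>
        interior_subset[of "natural_params \<nu>"] by blast+
  qed (fact nonzero assms)+
  show ?thesis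
    using assms(11,13) by (intro trans_kernel_convex_order) auto
qed

end
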